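(* Let $\alpha>0$, let $n>\max\left(3,\,1+\frac1\alpha\right)$ be an integer, let $X_1,\dots,X_n$ be i.i.d. random variables with the gamma density $\Gamma(\alpha)^{-1}e^{-x}x^{\alpha-1}$, $x>0$, and let $$U_n^2=\left(\sum_{i=1}^nX_i\right)^{-2}\sum_{i=1}^nX_i^2 .$$ For real $s$ and $t>0$ put $$\psi(s,t)=\left(\frac{i}{2t}\right)^{\alpha/2}\exp\left(\frac{i(1-is)^2}{8t}\right)D_{-\alpha}\left(\sqrt i\,\frac{1-is}{\sqrt{2t}}\right),\qquad t_k=\frac{k\pi}{\alpha^2n(n-1)}\quad(k\ge1).$$ Then for $0\le x\le1-\frac1n$ $$P\left\{U_n^2-n^{-1}\le x\right\}=\frac{\Gamma(\alpha n+1)}{\pi^2(\alpha n/e)^{\alpha n}}\lim_{K\to\infty}\int_{-\infty}^\infty\sum_{k=1}^K\Im\left\{\left(\psi(s,t_k)\right)^n\exp\left(-i\alpha ns-i(n-1)^{-1}k\pi\right)\right\}\frac{1-\cos\left((1-n^{-1})^{-1}k\pi x\right)}{k}\,ds .$$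
   Context: $D_{-\alpha}$ denotes the parabolic cylinder function (Abramowitz–Stegun 19.3.1); for $\alpha>0$ it is the entire function $$D_{-\alpha}(z)=\frac{e^{-z^2/4}}{\Gamma(\alpha)}\int_0^\infty t^{\alpha-1}e^{-t^2/2-zt}\,dt,\qquad z\in\mathbb C .$$ Principal branches of powers are used: $\sqrt i=e^{i\pi/4}$ and $(i/(2t))^{\alpha/2}=(2t)^{-\alpha/2}e^{i\pi\alpha/4}$. $\Im$ denotes the imaginary part. *)

theory Defs
  imports "HOL-Probability.Probability"
begin

(* D_nu(z) through its integral representation, which is valid for nu < 0 only. *)
definition parabolic_cylinder_D :: "real \<Rightarrow> complex \<Rightarrow> complex" where
  "parabolic_cylinder_D \<nu> z =
     exp (- z\<^sup>2 / 4) / complex_of_real (Gamma (- \<nu>)) *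
     (LBINT t:{0<..}. complex_of_real (t powr (- \<nu> - 1)) *
        exp (- (complex_of_real t)\<^sup>2 / 2 - z * complex_of_real t))"

definition gamma_density :: "real \<Rightarrow> real \<Rightarrow> real" where
  "gamma_density \<alpha> x =
     (if x > 0 then inverse (Gamma \<alpha>) * exp (- x) * x powr (\<alpha> - 1) else 0)"

definition U_sq :: "(nat \<Rightarrow> 'a \<Rightarrow> real) \<Rightarrow> nat \<Rightarrow> 'a \<Rightarrow> real" where
  "U_sq X n \<omega> = (\<Sum>i=1..n. (X i \<omega>)\<^sup>2) / (\<Sum>i=1..n. X i \<omega>)\<^sup>2"

(* csqrt and powr on complex numbers are the principal branches. *)
definition psi :: "real \<Rightarrow> real \<Rightarrow> real \<Rightarrow> complex" where
  "psi \<alpha> s t =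
     (\<i> / complex_of_real (2 * t)) powr complex_of_real (\<alpha> / 2) *
     exp (\<i> * (1 - \<i> * complex_of_real s)\<^sup>2 / complex_of_real (8 * t)) *
     parabolic_cylinder_D (- \<alpha>)
       (csqrt \<i> * ((1 - \<i> * complex_of_real s) / complex_of_real (sqrt (2 * t))))"

definition t_node :: "real \<Rightarrow> nat \<Rightarrow> nat \<Rightarrow> real" where
  "t_node \<alpha> n k = real k * pi / (\<alpha>\<^sup>2 * real n * (real n - 1))"

definition partial_integrand :: "real \<Rightarrow> nat \<Rightarrow> real \<Rightarrow> nat \<Rightarrow> real \<Rightarrow> real" where
  "partial_integrand \<alpha> n x K s =
     (\<Sum>k=1..K.
        Im (psi \<alpha> s (t_node \<alpha> n k) ^ n *
            exp (- \<i> * complex_of_real (\<alpha> * real n * s)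
                 - \<i> * complex_of_real (inverse (real n - 1) * real k * pi))) *
        ((1 - cos (inverse (1 - 1 / real n) * real k * pi * x)) / real k))"

end

theory Submission
  imports Defs "HOL-Real_Asymp.Real_Asymp"
begin

text \<open>
  Write $S = \sum X_i$, $\beta = \alpha n$, and $W = (U_n^2 - 1/n)/(1 - 1/n)$, which lies in $[0,1]$.

  Rotating the path of integration in the definition of $D_{-\alpha}$ by the angle $\pi/4$ shows that
  $\psi(s,t) = E \exp(isX + itX^2)$ for a gamma variable $X$ (\<open>psi_eq_expectation\<close>). By independence
  $\psi(s,t)^n = E \exp(isS + itS^2U_n^2)$. The gamma densities are homogeneous up to the factor
  $e^{-S}$, so $S$ is independent of the scale invariant quantity $U_n^2$ and has the gamma density with
  parameter $\beta$ (\<open>gamma_sum_independent_of_shape\<close>). Thus $\psi(\cdot,t)^n$ is the Fourier transform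
  of $r \mapsto \gamma_\beta(r)\, E \exp(itr^2U_n^2)$, and inverting it at the point $r = \beta$ conditions
  on $S = \beta$ and isolates the law of $U_n^2$ (\<open>psi_power_inversion\<close>). The inversion theorem needs
  $\psi(\cdot,t)^n$ to be integrable; this follows from $|\psi(s,t)| = O(|1-is|^{-\min(\alpha,1)})$
  (\<open>psi_decay\<close>) together with $\alpha n > 1$.

  The nodes $t_k$ are chosen so that $t_k\beta^2 = k\pi n/(n-1)$. The $k$-th integral therefore is a
  constant multiple of $E \sin(k\pi W)$, and the whole sum is, up to the constant, the expectation of
  $$\sum_{k=1}^K \sin(k\pi W)\,\frac{1-\cos(k\pi y)}{k}, \qquad y = \frac{x}{1-1/n}.$$
  By the sine series of the sawtooth function, these sums are bounded and tend to $\pi/2$ if $W < y$ and to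
  $0$ if $W > y$ (\<open>window_sum_tendsto\<close>). Dominated convergence gives $\frac{\pi}{2} P(W \le y)$,
  because $W$ has no atoms (\<open>AE_shape_ne\<close>).
\<close>

section \<open>Sine series of an indicator function\<close>

definition sine_sum :: "nat \<Rightarrow> real \<Rightarrow> real" where
  "sine_sum K \<theta> = (\<Sum>k=1..K. sin (real k * \<theta>) / real k)"

lemma Dirichlet_kernel:
  "sin (\<theta> / 2) * (1 + 2 * (\<Sum>k=1..K. cos (real k * \<theta>))) = sin ((2 * real K + 1) * (\<theta> / 2))"
proof (induction K)
  case (Suc K)
  have "sin ((2 * real (Suc K) + 1) * (\<theta> / 2)) - sin ((2 * real K + 1) * (\<theta> / 2))
      = 2 * sin (\<theta> / 2) * cos (real (Suc K) * \<theta>)"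
  proof -
    define u v where "u = \<theta> / 2" and "v = real (Suc K) * \<theta>"
    have "(2 * real (Suc K) + 1) * (\<theta> / 2) = v + u" "(2 * real K + 1) * (\<theta> / 2) = v - u"
      by (simp_all add: u_def v_def algebra_simps)
    then show ?thesis unfolding u_def[symmetric] v_def[symmetric] by (simp add: sin_add sin_diff)
  qed
  with Suc show ?case by (simp add: algebra_simps)
qed simp

text \<open>
  The remainder of the sine series has the derivative $-\sin((K+\frac12)\theta)/(2\sin(\theta/2))$ up to
  sign, whose size does not decrease with $K$; only its oscillation does. Adding the boundary term of one
  integration by parts, $\cos((K+\frac12)\theta)/((2K+1)\sin(\theta/2))$, leaves a derivative that is dominated by
  that of $1/((2K+1)\sin(\theta/2))$. Hence the corrected remainder \<open>E\<close> plus or minus \<open>B\<close> is monotone, and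
  \<open>E\<close> vanishes at $\pi$.
\<close>

lemma sine_sum_error:
  assumes "0 < \<theta>" "\<theta> \<le> pi"
  shows "\<bar>(pi - \<theta>) / 2 - sine_sum K \<theta>\<bar> \<le> 2 / ((2 * real K + 1) * sin (\<theta> / 2))"
proof -
  define m where "m = 2 * real K + 1"
  have m: "m > 0" by (simp add: m_def)
  define E where "E = (\<lambda>\<phi>. (pi - \<phi>) / 2 - sine_sum K \<phi> - cos (m * (\<phi> / 2)) / (m * sin (\<phi> / 2)))"
  define B where "B = (\<lambda>\<phi>. 1 / (m * sin (\<phi> / 2)))"
  define E' where "E' = (\<lambda>\<phi>. cos (m * (\<phi> / 2)) * cos (\<phi> / 2) / (2 * m * (sin (\<phi> / 2))\<^sup>2))"
  define B' where "B' = (\<lambda>\<phi>. - cos (\<phi> / 2) / (2 * m * (sin (\<phi> / 2))\<^sup>2))"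
  have pos: "sin (\<phi> / 2) > 0" if "\<theta> \<le> \<phi>" "\<phi> \<le> pi" for \<phi>
    using that assms by (intro sin_gt_zero) auto
  have dS: "(sine_sum K has_real_derivative (\<Sum>k=1..K. cos (real k * \<phi>))) (at \<phi>)" for \<phi>
    unfolding sine_sum_def by (auto intro!: derivative_eq_intros sum.cong)
  have dB: "(B has_real_derivative B' \<phi>) (at \<phi>)" if "\<theta> \<le> \<phi>" "\<phi> \<le> pi" for \<phi>
    unfolding B_def B'_def using pos[OF that] m
    by (auto intro!: derivative_eq_intros simp: field_simps power2_eq_square)
  have dE: "(E has_real_derivative E' \<phi>) (at \<phi>)" if "\<theta> \<le> \<phi>" "\<phi> \<le> pi" for \<phi>
  proof -
    have s: "sin (\<phi> / 2) > 0" by (rule pos[OF that])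
    have "(E has_real_derivative (- 1 / 2 - (\<Sum>k=1..K. cos (real k * \<phi>))
       - (- (sin (m * (\<phi> / 2)) * (m / 2)) * (m * sin (\<phi> / 2)) - cos (m * (\<phi> / 2)) * (m * (cos (\<phi> / 2) / 2)))
          / ((m * sin (\<phi> / 2)) * (m * sin (\<phi> / 2))))) (at \<phi>)"
      unfolding E_def using s m
      by (auto intro!: derivative_eq_intros dS)
    moreover have "- 1 / 2 - (\<Sum>k=1..K. cos (real k * \<phi>)) = - sin (m * (\<phi> / 2)) / (2 * sin (\<phi> / 2))"
      using Dirichlet_kernel[of \<phi> K] s by (simp add: m_def field_simps)
    ultimately show ?thesis
      unfolding E'_def using s m by (simp add: field_simps power2_eq_square)
  qed
  have le: "\<bar>E' \<phi>\<bar> \<le> - B' \<phi>" if "\<theta> \<le> \<phi>" "\<phi> \<le> pi" for \<phi>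
  proof -
    have "cos (\<phi> / 2) \<ge> 0" using that assms by (intro cos_ge_zero) auto
    then show ?thesis using pos[OF that] m
      by (auto simp: E'_def B'_def abs_mult intro!: divide_right_mono mult_left_le_one_le)
  qed
  have Epi: "E pi = 0"
  proof -
    have "cos (m * (pi / 2)) = 0"
      by (simp add: m_def algebra_simps cos_add)
    moreover have "sine_sum K pi = 0" by (simp add: sine_sum_def)
    ultimately show ?thesis by (simp add: E_def)
  qed
  have "E pi + B pi \<le> E \<theta> + B \<theta>"
    using assms(2)
  proof (rule DERIV_nonpos_imp_nonincreasing)
    fix \<phi> assume *: "\<theta> \<le> \<phi>" "\<phi> \<le> pi"
    show "\<exists>y. ((\<lambda>\<phi>. E \<phi> + B \<phi>) has_real_derivative y) (at \<phi>) \<and> y \<le> 0"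
      using le[OF *] by (intro exI[of _ "E' \<phi> + B' \<phi>"] conjI DERIV_add dE dB *) auto
  qed
  moreover have "E \<theta> - B \<theta> \<le> E pi - B pi"
    using assms(2)
  proof (rule DERIV_nonneg_imp_nondecreasing)
    fix \<phi> assume *: "\<theta> \<le> \<phi>" "\<phi> \<le> pi"
    show "\<exists>y. ((\<lambda>\<phi>. E \<phi> - B \<phi>) has_real_derivative y) (at \<phi>) \<and> y \<ge> 0"
      using le[OF *] by (intro exI[of _ "E' \<phi> - B' \<phi>"] conjI DERIV_diff dE dB *) auto
  qed
  moreover have "B pi \<ge> 0" using m by (simp add: B_def)
  ultimately have "\<bar>E \<theta>\<bar> \<le> B \<theta>" using Epi by linarith
  moreover have "\<bar>cos (m * (\<theta> / 2)) / (m * sin (\<theta> / 2))\<bar> \<le> B \<theta>"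
    using pos[of \<theta>] assms m by (auto simp: B_def abs_mult intro!: divide_right_mono)
  moreover have "\<bar>a\<bar> \<le> 2 * b" if "\<bar>a - c\<bar> \<le> b" "\<bar>c\<bar> \<le> b" for a b c :: real
    using that by linarith
  ultimately have "\<bar>(pi - \<theta>) / 2 - sine_sum K \<theta>\<bar> \<le> 2 * B \<theta>"
    unfolding E_def by blast
  then show ?thesis by (simp add: B_def m_def)
qed

lemma sine_sum_uminus: "sine_sum K (- \<theta>) = - sine_sum K \<theta>"
  by (simp add: sine_sum_def sum_negf)

lemma sine_sum_reflect: "sine_sum K (2 * pi - \<theta>) = - sine_sum K \<theta>"
proof -
  have "sin (real k * (2 * pi - \<theta>)) = - sin (real k * \<theta>)" for k
  proof -
    have "real k * (2 * pi - \<theta>) = 2 * real k * pi - real k * \<theta>"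
      by (simp add: algebra_simps)
    then show ?thesis by (simp only: sin_diff sin_2npi cos_2npi)
  qed
  then show ?thesis by (simp add: sine_sum_def sum_negf)
qed

lemma sine_sum_tendsto:
  assumes "0 < \<theta>" "\<theta> < 2 * pi"
  shows "(\<lambda>K. sine_sum K \<theta>) \<longlonglongrightarrow> (pi - \<theta>) / 2"
proof -
  have *: "(\<lambda>K. sine_sum K \<theta>) \<longlonglongrightarrow> (pi - \<theta>) / 2" if \<theta>: "0 < \<theta>" "\<theta> \<le> pi" for \<theta>
  proof -
    have "(\<lambda>K. 2 / ((2 * real K + 1) * sin (\<theta> / 2))) \<longlonglongrightarrow> 0"
    proof -
      have "sin (\<theta> / 2) > 0" using \<theta> by (intro sin_gt_zero) auto
      then show ?thesis by real_asymp
    qed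
    then have "(\<lambda>K. (pi - \<theta>) / 2 - sine_sum K \<theta>) \<longlonglongrightarrow> 0"
      by (rule Lim_null_comparison[rotated]) (use sine_sum_error[OF \<theta>] in \<open>auto simp del: divide_divide_eq_left\<close>)
    from tendsto_diff[OF tendsto_const[of "(pi - \<theta>) / 2"] this] show ?thesis by simp
  qed
  show ?thesis
  proof (cases "\<theta> \<le> pi")
    case False
    have "(\<lambda>K. - sine_sum K (2 * pi - \<theta>)) \<longlonglongrightarrow> - ((pi - (2 * pi - \<theta>)) / 2)"
      using False assms by (intro tendsto_minus *) auto
    moreover have "- ((pi - (2 * pi - \<theta>)) / 2) = (pi - \<theta>) / 2" by (simp add: field_simps)
    ultimately show ?thesis by (simp only: sine_sum_reflect minus_minus)
  qed (use assms * in auto)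
qed

text \<open>
  If $K\theta \le 1$, each of the $K$ terms is at most $\theta$; otherwise the error bound applies, and
  $(2K+1)\sin(\theta/2)$ is bounded below because $\sin(\theta/2)$ is at least a multiple of $\theta$.
\<close>

lemma sine_sum_bounded:
  assumes "- pi \<le> \<theta>" "\<theta> \<le> 2 * pi"
  shows "\<bar>sine_sum K \<theta>\<bar> \<le> 2 + 2 * pi"
proof -
  have *: "\<bar>sine_sum K \<theta>\<bar> \<le> 2 + 2 * pi" if \<theta>: "0 \<le> \<theta>" "\<theta> \<le> pi" for \<theta>
  proof (cases "real K * \<theta> \<le> 1")
    case True
    have "\<bar>sine_sum K \<theta>\<bar> \<le> (\<Sum>k=1..K. \<bar>sin (real k * \<theta>) / real k\<bar>)"
      unfolding sine_sum_def by (rule sum_abs)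
    also have "\<dots> \<le> (\<Sum>k=1..K. \<theta>)"
    proof (rule sum_mono)
      fix k assume "k \<in> {1..K}"
      then show "\<bar>sin (real k * \<theta>) / real k\<bar> \<le> \<theta>"
        using abs_sin_x_le_abs_x[of "real k * \<theta>"] \<theta> by (auto simp: field_simps abs_mult)
    qed
    also have "\<dots> \<le> 1" using True by simp
    finally show ?thesis using pi_ge_zero by linarith
  next
    case False
    with \<theta> have pos: "\<theta> > 0" by (cases "\<theta> = 0") auto
    have s: "sin (\<theta> / 2) \<ge> \<theta> / (2 * pi)"
    proof -
      define u where "u = \<theta> / 4"
      have u: "0 \<le> u" "u \<le> pi / 4" using \<theta> by (auto simp: u_def)
      have c: "cos u \<ge> sqrt 2 / 2" using cos_monotone_0_pi_le[of u "pi / 4"] u by (simp add: cos_45)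
      \<comment> \<open>Doubling the angle keeps the elementary bound away from the point where the cosine vanishes.\<close>
      have "u * cos u \<le> sin u"
      proof -
        have "sin 0 - 0 * cos 0 \<le> sin u - u * cos u"
          using u(1)
        proof (rule DERIV_nonneg_imp_nondecreasing)
          fix v assume v: "0 \<le> v" "v \<le> u"
          have "((\<lambda>u. sin u - u * cos u) has_real_derivative v * sin v) (at v)"
            by (auto intro!: derivative_eq_intros)
          moreover have "v * sin v \<ge> 0" using v u by (intro mult_nonneg_nonneg sin_ge_zero) auto
          ultimately show "\<exists>y. ((\<lambda>u. sin u - u * cos u) has_real_derivative y) (at v) \<and> y \<ge> 0" by blast
        qed
        then show ?thesis by simp
      qed
      then have "2 * (u * cos u) * cos u \<le> 2 * sin u * cos u"
        using c real_sqrt_ge_zero[of 2] by (intro mult_right_mono) linarith+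
      moreover have "1 / 2 \<le> cos u * cos u"
        using mult_mono[OF c c] c by (auto intro: order_trans[rotated])
      then have "2 * u * (1 / 2) \<le> 2 * u * (cos u * cos u)" using u by (intro mult_left_mono) auto
      ultimately have "u \<le> sin (2 * u)" unfolding sin_double by (simp add: mult_ac)
      moreover have "\<theta> / (2 * pi) \<le> u" using mult_right_mono[of 2 pi \<theta>] pi_gt3 \<theta> by (simp add: u_def field_simps)
      ultimately show ?thesis by (simp add: u_def)
    qed
    have "(2 * real K + 1) * sin (\<theta> / 2) \<ge> (2 * real K) * (\<theta> / (2 * pi))"
      using s \<theta> by (intro mult_mono) auto
    moreover have "(2 * real K) * (\<theta> / (2 * pi)) \<ge> 1 / pi" using False by (simp add: field_simps)
    ultimately have "1 / pi \<le> (2 * real K + 1) * sin (\<theta> / 2)" by linarith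
    moreover have "2 / c \<le> 2 / (1 / pi)" if "1 / pi \<le> c" for c
      using that less_le_trans[of 0 "1 / pi" c] by (intro divide_left_mono) auto
    ultimately have "2 / ((2 * real K + 1) * sin (\<theta> / 2)) \<le> 2 / (1 / pi)" by blast
    then have "\<bar>(pi - \<theta>) / 2 - sine_sum K \<theta>\<bar> \<le> 2 * pi"
      using sine_sum_error[OF pos \<theta>(2), of K] by simp
    moreover have "0 \<le> (pi - \<theta>) / 2" "(pi - \<theta>) / 2 \<le> 2" using \<theta> pi_less_4 by auto
    ultimately show ?thesis by linarith
  qed
  consider "\<theta> < 0" | "0 \<le> \<theta>" "\<theta> \<le> pi" | "pi < \<theta>" by linarith
  then show ?thesis
  proof cases
    case 1 then show ?thesis using *[of "-\<theta>"] assms by (simp add: sine_sum_uminus)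
  next
    case 3 then show ?thesis using *[of "2 * pi - \<theta>"] assms by (simp add: sine_sum_reflect)
  qed (use * in auto)
qed

text \<open>
  By the product formula for sine and cosine, the kernel that occurs in the theorem is a combination of three sawtooth
  sums. Their limits are piecewise linear in $w$; the linear parts cancel for $w > y$, and the jump of the third one at
  $w = y$ remains for $w < y$.
\<close>

lemma window_sum_eq:
  "(\<Sum>k=1..K. sin (real k * pi * w) * ((1 - cos (real k * pi * y)) / real k))
    = sine_sum K (pi * w) - (sine_sum K (pi * (w + y)) + sine_sum K (pi * (w - y))) / 2"
proof -
  have "sin (real k * pi * w) * ((1 - cos (real k * pi * y)) / real k)
      = sin (real k * (pi * w)) / real k - (sin (real k * (pi * (w + y))) / real k
         + sin (real k * (pi * (w - y))) / real k) / 2" for k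
    using sin_times_cos[of "real k * pi * w" "real k * pi * y"]
    by (simp add: algebra_simps diff_divide_distrib add_divide_distrib sin_add sin_diff)
  then show ?thesis
    by (simp add: sine_sum_def sum_subtractf sum.distrib sum_divide_distrib[symmetric])
qed

lemma window_sum_bounded:
  assumes "0 \<le> w" "w \<le> 1" "0 \<le> y" "y \<le> 1"
  shows "\<bar>\<Sum>k=1..K. sin (real k * pi * w) * ((1 - cos (real k * pi * y)) / real k)\<bar> \<le> 4 + 4 * pi"
proof -
  have "\<bar>sine_sum K (pi * w)\<bar> \<le> 2 + 2 * pi" "\<bar>sine_sum K (pi * (w + y))\<bar> \<le> 2 + 2 * pi"
    "\<bar>sine_sum K (pi * (w - y))\<bar> \<le> 2 + 2 * pi"
  proof -
    have *: "\<bar>sine_sum K (pi * v)\<bar> \<le> 2 + 2 * pi" if "- 1 \<le> v" "v \<le> 2" for v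
      using mult_left_mono[OF that(1), of pi] mult_left_mono[OF that(2), of pi]
      by (intro sine_sum_bounded) (auto simp: mult.commute)
    show "\<bar>sine_sum K (pi * w)\<bar> \<le> 2 + 2 * pi" "\<bar>sine_sum K (pi * (w + y))\<bar> \<le> 2 + 2 * pi"
      "\<bar>sine_sum K (pi * (w - y))\<bar> \<le> 2 + 2 * pi"
      using assms by (auto intro!: *)
  qed
  moreover have "\<bar>a - (b + c) / 2\<bar> \<le> 4 + 4 * pi"
    if "\<bar>a\<bar> \<le> 2 + 2 * pi" "\<bar>b\<bar> \<le> 2 + 2 * pi" "\<bar>c\<bar> \<le> 2 + 2 * pi" for a b c :: real
    using that unfolding abs_le_iff by (auto simp: field_simps)
  ultimately show ?thesis unfolding window_sum_eq by blast
qed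

lemma window_sum_tendsto:
  assumes "0 < w" "w < 1" "0 \<le> y" "y \<le> 1" "w \<noteq> y"
  shows "(\<lambda>K. \<Sum>k=1..K. sin (real k * pi * w) * ((1 - cos (real k * pi * y)) / real k))
           \<longlonglongrightarrow> (if w \<le> y then pi / 2 else 0)"
proof -
  have L: "(\<lambda>K. sine_sum K (pi * v)) \<longlonglongrightarrow> (pi - pi * v) / 2" if "0 < v" "v < 2" for v
    using that by (intro sine_sum_tendsto) auto
  show ?thesis
  proof (cases "w \<le> y")
    case True
    have "(\<lambda>K. - sine_sum K (pi * (y - w))) \<longlonglongrightarrow> - ((pi - pi * (y - w)) / 2)"
      using assms True by (intro tendsto_minus L) auto
    also have "(\<lambda>K. - sine_sum K (pi * (y - w))) = (\<lambda>K. sine_sum K (pi * (w - y)))"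
      by (subst sine_sum_uminus[symmetric]) (simp add: algebra_simps)
    finally have "(\<lambda>K. sine_sum K (pi * w) - (sine_sum K (pi * (w + y)) + sine_sum K (pi * (w - y))) / 2)
      \<longlonglongrightarrow> (pi - pi * w) / 2 - ((pi - pi * (w + y)) / 2 + - ((pi - pi * (y - w)) / 2)) / 2"
      using assms True by (intro tendsto_intros L) auto
    also have "(pi - pi * w) / 2 - ((pi - pi * (w + y)) / 2 + - ((pi - pi * (y - w)) / 2)) / 2 = pi / 2"
      by (simp add: field_simps)
    finally show ?thesis using True unfolding window_sum_eq by simp
  next
    case False
    have "(\<lambda>K. sine_sum K (pi * w) - (sine_sum K (pi * (w + y)) + sine_sum K (pi * (w - y))) / 2)
      \<longlonglongrightarrow> (pi - pi * w) / 2 - ((pi - pi * (w + y)) / 2 + (pi - pi * (w - y)) / 2) / 2"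
      using assms False by (intro tendsto_intros L) auto
    also have "(pi - pi * w) / 2 - ((pi - pi * (w + y)) / 2 + (pi - pi * (w - y)) / 2) / 2 = 0"
      by (simp add: field_simps)
    finally show ?thesis using False unfolding window_sum_eq by simp
  qed
qed

section \<open>Fourier inversion by Gaussian smoothing\<close>

lemma gaussian_fourier:
  fixes \<sigma> v :: real
  assumes "\<sigma> > 0"
  shows "integrable lborel (\<lambda>s. iexp (s * v) * complex_of_real (exp (- (\<sigma> * s)\<^sup>2 / 2)))" (is ?A)
    and "(LBINT s. iexp (s * v) * complex_of_real (exp (- (\<sigma> * s)\<^sup>2 / 2)))
           = complex_of_real (2 * pi / \<sigma> * std_normal_density (v / \<sigma>))" (is ?B)
proof -
  define f where "f = (\<lambda>x. complex_of_real (std_normal_density x) * iexp (v / \<sigma> * x))"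
  have [measurable]: "f \<in> borel_measurable borel" unfolding f_def by measurable
  have int: "integrable lborel f"
    by (rule Bochner_Integration.integrable_bound[OF integrable_normal_density[of 1 0]])
       (auto simp: f_def norm_mult simp del: of_real_exp)
  have eq: "f (0 + \<sigma> * s) = complex_of_real (1 / sqrt (2 * pi)) * (iexp (s * v) * complex_of_real (exp (- (\<sigma> * s)\<^sup>2 / 2)))" for s
    using assms by (simp add: f_def std_normal_density_def mult.commute)
  have "integrable lborel (\<lambda>s. f (0 + \<sigma> * s))"
    using int assms by (intro lborel_integrable_real_affine) auto
  then have "integrable lborel (\<lambda>s. complex_of_real (sqrt (2 * pi)) * f (0 + \<sigma> * s))"
    by (rule integrable_mult_right)
  then show ?A unfolding eq mult.assoc[symmetric] of_real_mult[symmetric] by simp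
  have "integral\<^sup>L lborel f = char std_normal_distribution (v / \<sigma>)"
    unfolding char_def f_def by (subst integral_density) (auto simp: scaleR_conv_of_real)
  also have "\<dots> = complex_of_real (exp (- ((v / \<sigma>)\<^sup>2) / 2))"
    by (simp add: char_std_normal_distribution)
  finally have I: "integral\<^sup>L lborel f = complex_of_real (exp (- ((v / \<sigma>)\<^sup>2) / 2))" .
  have "integral\<^sup>L lborel f = \<bar>\<sigma>\<bar> *\<^sub>R (LBINT s. f (0 + \<sigma> * s))"
    using assms by (intro lborel_integral_real_affine) auto
  also have "\<dots> = complex_of_real (\<sigma> / sqrt (2 * pi)) * (LBINT s. iexp (s * v) * complex_of_real (exp (- (\<sigma> * s)\<^sup>2 / 2)))"
    unfolding eq integral_mult_right_zero using assms by (simp add: scaleR_conv_of_real)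
  finally have J: "complex_of_real (\<sigma> / sqrt (2 * pi)) * (LBINT s. iexp (s * v) * complex_of_real (exp (- (\<sigma> * s)\<^sup>2 / 2)))
      = complex_of_real (exp (- ((v / \<sigma>)\<^sup>2) / 2))"
    using I by simp
  have nz: "\<sigma> / sqrt (2 * pi) \<noteq> 0" using assms by simp
  have "(LBINT s. iexp (s * v) * complex_of_real (exp (- (\<sigma> * s)\<^sup>2 / 2)))
      = complex_of_real (exp (- ((v / \<sigma>)\<^sup>2) / 2) / (\<sigma> / sqrt (2 * pi)))"
    using J nz by (simp only: of_real_divide) (auto simp: field_simps)
  also have "exp (- ((v / \<sigma>)\<^sup>2) / 2) / (\<sigma> / sqrt (2 * pi)) = 2 * pi / \<sigma> * std_normal_density (v / \<sigma>)"
  proof -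
    define S where "S = sqrt (2 * pi)"
    have S: "S > 0" "2 * pi = S * S" by (simp_all add: S_def)
    have "std_normal_density (v / \<sigma>) = 1 / S * exp (- ((v / \<sigma>)\<^sup>2) / 2)"
      by (simp add: std_normal_density_def S_def)
    then show ?thesis using assms S(1) unfolding S(2) real_sqrt_mult_self by simp
  qed
  finally show ?B .
qed

text \<open>
  Multiplying the transform by a Gaussian makes Fubini's theorem applicable and turns the inversion integral into a
  Gaussian average of $g$ around $a$. As the width \<open>\<sigma> m\<close> tends to $0$, the two sides converge
  by dominated convergence: the left one because $G$ is integrable, the right one because $g$ is bounded and
  continuous at $a$.
\<close>

theorem Fourier_inversion:
  fixes g :: "real \<Rightarrow> complex" and a :: real
  defines "G \<equiv> \<lambda>s. LBINT r. iexp (s * r) * g r"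
  assumes g: "integrable lborel g" and bnd: "\<And>r. norm (g r) \<le> B" and cont: "isCont g a"
    and G: "integrable lborel G"
  shows "(LBINT s. G s * iexp (- (s * a))) = complex_of_real (2 * pi) * g a"
proof -
  have [measurable]: "g \<in> borel_measurable borel" "G \<in> borel_measurable borel"
    using g G by auto
  define \<sigma> where "\<sigma> = (\<lambda>m. 1 / real (Suc m))"
  have \<sigma>: "\<sigma> m > 0" for m by (simp add: \<sigma>_def)
  have \<sigma>0: "\<sigma> \<longlonglongrightarrow> 0" unfolding \<sigma>_def using LIMSEQ_inverse_real_of_nat by (simp add: inverse_eq_divide)
  define A where "A = (\<lambda>m. LBINT s. G s * iexp (- (s * a)) * complex_of_real (exp (- (\<sigma> m * s)\<^sup>2 / 2)))"
  have lim1: "A \<longlonglongrightarrow> (LBINT s. G s * iexp (- (s * a)))"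
    unfolding A_def
  proof (rule integral_dominated_convergence[where w = "\<lambda>s. norm (G s)"])
    show "AE s in lborel. (\<lambda>m. G s * iexp (- (s * a)) * complex_of_real (exp (- (\<sigma> m * s)\<^sup>2 / 2))) \<longlonglongrightarrow> G s * iexp (- (s * a))"
    proof (intro AE_I2)
      fix s
      have "(\<lambda>m. G s * iexp (- (s * a)) * complex_of_real (exp (- (\<sigma> m * s)\<^sup>2 / 2)))
          \<longlonglongrightarrow> G s * iexp (- (s * a)) * complex_of_real (exp (- (0 * s)\<^sup>2 / 2))"
        by (intro tendsto_intros \<sigma>0) simp
      then show "(\<lambda>m. G s * iexp (- (s * a)) * complex_of_real (exp (- (\<sigma> m * s)\<^sup>2 / 2))) \<longlonglongrightarrow> G s * iexp (- (s * a))"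
        by simp
    qed
    show "AE s in lborel. norm (G s * iexp (- (s * a)) * complex_of_real (exp (- (\<sigma> m * s)\<^sup>2 / 2))) \<le> norm (G s)" for m
      by (auto simp: norm_mult intro!: mult_right_le_one_le simp del: of_real_exp)
  qed (use G in auto)
  have A_eq: "A m = complex_of_real (2 * pi) * (LBINT v. g (a + \<sigma> m * v) * complex_of_real (std_normal_density v))" for m
  proof -
    \<comment> \<open>The integrand of the smoothed inversion integral, before either variable is integrated out.\<close>
    define k where "k = (\<lambda>(s, r). g r * (iexp (s * (r - a)) * complex_of_real (exp (- (\<sigma> m * s)\<^sup>2 / 2))))"
    have [measurable]: "k \<in> borel_measurable (lborel \<Otimes>\<^sub>M lborel)" unfolding k_def by measurable
    have gi: "integrable lborel (\<lambda>s. exp (- (\<sigma> m * s)\<^sup>2 / 2))"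
      using gaussian_fourier(1)[OF \<sigma>[of m], of 0] by (simp del: of_real_exp add: complex_of_real_integrable_eq)
    have ki: "integrable (lborel \<Otimes>\<^sub>M lborel) k"
    proof (rule lborel_pair.Fubini_integrable)
      have "(LBINT r. norm (k (s, r))) = exp (- (\<sigma> m * s)\<^sup>2 / 2) * (LBINT r. norm (g r))" for s
        by (simp add: k_def norm_mult del: of_real_exp flip: integral_mult_right_zero) (simp add: mult.commute)
      then show "integrable lborel (\<lambda>s. LBINT r. norm (k (s, r)))"
        using gi by simp
      show "AE s in lborel. integrable lborel (\<lambda>r. k (s, r))"
      proof (intro AE_I2)
        fix s
        show "integrable lborel (\<lambda>r. k (s, r))"
          by (rule Bochner_Integration.integrable_bound[OF g])
             (auto simp: k_def norm_mult intro!: mult_right_le_one_le simp del: of_real_exp)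
      qed
    qed simp
    have "A m = (LBINT s. LBINT r. k (s, r))"
      unfolding A_def
    proof (rule Bochner_Integration.integral_cong[OF refl])
      fix s
      have "(LBINT r. k (s, r)) = (LBINT r. (iexp (s * r) * g r) * (iexp (- (s * a)) * complex_of_real (exp (- (\<sigma> m * s)\<^sup>2 / 2))))"
      proof (rule Bochner_Integration.integral_cong[OF refl])
        fix r
        have "iexp (s * (r - a)) = iexp (s * r) * iexp (- (s * a))"
          by (simp add: exp_add[symmetric] algebra_simps)
        then show "k (s, r) = (iexp (s * r) * g r) * (iexp (- (s * a)) * complex_of_real (exp (- (\<sigma> m * s)\<^sup>2 / 2)))"
          by (simp add: k_def mult_ac)
      qed
      also have "\<dots> = G s * (iexp (- (s * a)) * complex_of_real (exp (- (\<sigma> m * s)\<^sup>2 / 2)))"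
        unfolding G_def by (rule integral_mult_left_zero)
      finally show "G s * iexp (- (s * a)) * complex_of_real (exp (- (\<sigma> m * s)\<^sup>2 / 2)) = (LBINT r. k (s, r))"
        by (simp add: mult.assoc)
    qed
    also have "\<dots> = (LBINT r. LBINT s. k (s, r))"
      using lborel_pair.Fubini_integral[of "\<lambda>s r. k (s, r)"] ki by simp
    also have "\<dots> = (LBINT r. g r * complex_of_real (2 * pi / \<sigma> m * std_normal_density ((r - a) / \<sigma> m)))"
      by (simp only: k_def prod.case integral_mult_right_zero gaussian_fourier(2)[OF \<sigma>])
    also have "\<dots> = \<bar>\<sigma> m\<bar> *\<^sub>R (LBINT v. g (a + \<sigma> m * v) * complex_of_real (2 * pi / \<sigma> m * std_normal_density ((a + \<sigma> m * v - a) / \<sigma> m)))"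
      using \<sigma>[of m] by (intro lborel_integral_real_affine) auto
    also have "\<dots> = complex_of_real (\<sigma> m) * (LBINT v. complex_of_real (2 * pi / \<sigma> m) * (g (a + \<sigma> m * v) * complex_of_real (std_normal_density v)))"
      using \<sigma>[of m] by (simp add: scaleR_conv_of_real mult_ac)
    also have "\<dots> = complex_of_real (2 * pi) * (LBINT v. g (a + \<sigma> m * v) * complex_of_real (std_normal_density v))"
      unfolding integral_mult_right_zero using \<sigma>[of m] by (simp add: field_simps)
    finally show ?thesis .
  qed
  have "(\<lambda>m. LBINT v. g (a + \<sigma> m * v) * complex_of_real (std_normal_density v)) \<longlonglongrightarrow> (LBINT v. g a * complex_of_real (std_normal_density v))"
  proof (rule integral_dominated_convergence[where w = "\<lambda>v. B * std_normal_density v"])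
    show "AE v in lborel. (\<lambda>m. g (a + \<sigma> m * v) * complex_of_real (std_normal_density v)) \<longlonglongrightarrow> g a * complex_of_real (std_normal_density v)"
    proof (intro AE_I2 tendsto_mult tendsto_const)
      fix v
      have "(\<lambda>m. a + \<sigma> m * v) \<longlonglongrightarrow> a + 0 * v" by (intro tendsto_intros \<sigma>0)
      then show "(\<lambda>m. g (a + \<sigma> m * v)) \<longlonglongrightarrow> g a"
        using cont by (intro isCont_tendsto_compose[of a g]) auto
    qed
    show "AE v in lborel. norm (g (a + \<sigma> m * v) * complex_of_real (std_normal_density v)) \<le> B * std_normal_density v" for m
      using bnd by (auto simp: norm_mult intro!: mult_right_mono)
  qed (auto intro!: integrable_normal_density)
  also have "(LBINT v. g a * complex_of_real (std_normal_density v)) = g a"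
    unfolding integral_mult_right_zero integral_complex_of_real using integral_normal_density[of 1 0] by simp
  finally have "A \<longlonglongrightarrow> complex_of_real (2 * pi) * g a"
    unfolding A_eq[abs_def] by (intro tendsto_intros)
  with lim1 show ?thesis by (rule LIMSEQ_unique)
qed

section \<open>Rotation of the ray of integration\<close>

lemma gamma_integral:
  fixes a c :: real
  assumes "a > 0" "c > 0"
  shows "has_bochner_integral lborel (\<lambda>y. indicator {0<..} y * (y powr (a - 1) * exp (- (c * y))))
    (Gamma a / c powr a)"
proof (rule has_bochner_integral_nn_integral)
  have eq: "ennreal (indicator {0..} (0 + c * y) * (0 + c * y) powr (a - 1) / exp (0 + c * y))
     = ennreal (c powr (a - 1)) * ennreal (indicator {0<..} y * (y powr (a - 1) * exp (- (c * y))))" for y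
    using assms by (auto simp: indicator_def powr_mult exp_minus zero_le_mult_iff divide_inverse ennreal_mult[symmetric])
  have "ennreal (Gamma a) = (\<integral>\<^sup>+y. ennreal (indicator {0..} y * y powr (a - 1) / exp y) \<partial>lborel)"
    by (rule Gamma_conv_nn_integral_real[OF assms(1)])
  also have "\<dots> = ennreal \<bar>c\<bar> * (\<integral>\<^sup>+y. ennreal (indicator {0..} (0 + c * y) * (0 + c * y) powr (a - 1) / exp (0 + c * y)) \<partial>lborel)"
    using assms by (intro nn_integral_real_affine) auto
  also have "\<dots> = ennreal (c * c powr (a - 1)) * (\<integral>\<^sup>+y. ennreal (indicator {0<..} y * (y powr (a - 1) * exp (- (c * y)))) \<partial>lborel)"
    unfolding eq using assms by (subst nn_integral_cmult) (auto simp: ennreal_mult mult.assoc)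
  also have "c * c powr (a - 1) = c powr a" using assms by (simp add: powr_diff)
  finally have *: "ennreal (Gamma a) = ennreal (c powr a) * (\<integral>\<^sup>+y. ennreal (indicator {0<..} y * (y powr (a - 1) * exp (- (c * y)))) \<partial>lborel)" .
  have "ennreal (Gamma a / c powr a) = ennreal (1 / c powr a) * ennreal (Gamma a)"
    using assms by (subst ennreal_mult[symmetric]) auto
  also have "\<dots> = (\<integral>\<^sup>+y. ennreal (indicator {0<..} y * (y powr (a - 1) * exp (- (c * y)))) \<partial>lborel)"
    unfolding * using assms by (subst mult.assoc[symmetric], subst ennreal_mult[symmetric]) auto
  finally show "(\<integral>\<^sup>+y. ennreal (indicator {0<..} y * (y powr (a - 1) * exp (- (c * y)))) \<partial>lborel) = ennreal (Gamma a / c powr a)" ..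
qed (use assms in \<open>auto intro!: divide_nonneg_nonneg simp: less_imp_le\<close>)

lemma FTC_half_line:
  fixes F f :: "real \<Rightarrow> 'b::euclidean_space" and a :: real
  assumes "\<And>x. a < x \<Longrightarrow> (F has_vector_derivative f x) (at x)" "\<And>x. a < x \<Longrightarrow> isCont f x"
    and "set_integrable lborel {a<..} f" "(F \<longlongrightarrow> A) (at_right a)" "(F \<longlongrightarrow> B) at_top"
  shows "(LBINT x:{a<..}. f x) = B - A"
proof -
  have "(LBINT x=ereal a..\<infinity>. f x) = B - A"
    by (rule interval_integral_FTC_integrable) (use assms in \<open>simp_all add: ereal_tendsto_simps1\<close>)
  then show ?thesis by (simp add: interval_lebesgue_integral_def)
qed

text \<open>
  The integrand of $\int_0^\infty w^{\alpha-1} e^{itw^2-(1-is)w}\,dw$ on the ray $w = e^{i\theta}y$, the differential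
  $dw = e^{i\theta}dy$ included. For $\theta = 0$ it gives a Fourier integral over the gamma density, for
  $\theta = \pi/4$, where $itw^2 = -ty^2$, the integral in the definition of $D_{-\alpha}$.
\<close>

definition rotated_kernel :: "real \<Rightarrow> real \<Rightarrow> real \<Rightarrow> real \<Rightarrow> real \<Rightarrow> complex" where
  "rotated_kernel \<alpha> s t \<theta> y = iexp (\<alpha> * \<theta>) * complex_of_real (y powr (\<alpha> - 1)) *
     exp (\<i> * t * (iexp \<theta> * y)\<^sup>2 - (1 - \<i> * s) * (iexp \<theta> * y))"

text \<open>
  The real part of the exponent is $-2ty^2\sin\theta\cos\theta - y\cos\theta - sy\sin\theta$. For negative $s$ the last
  term grows with $y$, but completing the square against the first one bounds it by $s^2/(4t)$. So the
  kernels of all angles have one common integrable majorant.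
\<close>

lemma rotated_kernel_bound:
  assumes "t > 0" "0 \<le> \<theta>" "\<theta> \<le> pi / 4" "y > 0"
  shows "norm (rotated_kernel \<alpha> s t \<theta> y) \<le> exp (s\<^sup>2 / (4 * t)) * (y powr (\<alpha> - 1) * exp (- (1 / 2 * y)))"
proof -
  have ie: "iexp \<theta> = cis \<theta>" by (simp add: cis_conv_exp)
  have c: "cos \<theta> \<ge> 1 / 2"
  proof -
    have "cos (pi / 3) \<le> cos \<theta>" using assms pi_gt_zero by (intro cos_monotone_0_pi_le) auto
    then show ?thesis by (simp add: cos_60)
  qed
  have s: "0 \<le> sin \<theta>" using assms pi_gt_zero by (intro sin_ge_zero) linarith+
  have s1: "sin \<theta> \<le> 1" by simp
  have "Re (\<i> * t * (iexp \<theta> * y)\<^sup>2 - (1 - \<i> * s) * (iexp \<theta> * y))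
     = - 2 * t * y\<^sup>2 * sin \<theta> * cos \<theta> - y * cos \<theta> - s * y * sin \<theta>"
    unfolding ie by (simp add: power2_eq_square algebra_simps)
  also have "\<dots> \<le> s\<^sup>2 / (4 * t) - 1 / 2 * y"
  proof -
    have "t * y\<^sup>2 * sin \<theta> * (2 * cos \<theta>) \<ge> t * y\<^sup>2 * sin \<theta> * 1"
      using c s assms by (intro mult_left_mono) auto
    moreover have "y * cos \<theta> \<ge> y * (1 / 2)" using c assms by (intro mult_left_mono) auto
    moreover have "- (t * y\<^sup>2 * sin \<theta>) - s * y * sin \<theta> = sin \<theta> * (s\<^sup>2 / (4 * t) - t * (y + s / (2 * t))\<^sup>2)"
      using assms by (simp add: field_simps power2_eq_square)
    moreover have "sin \<theta> * (s\<^sup>2 / (4 * t) - t * (y + s / (2 * t))\<^sup>2) \<le> sin \<theta> * (s\<^sup>2 / (4 * t))"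
      using s assms by (intro mult_left_mono) auto
    moreover have "sin \<theta> * (s\<^sup>2 / (4 * t)) \<le> 1 * (s\<^sup>2 / (4 * t))"
      using s s1 assms by (intro mult_right_mono) auto
    ultimately show ?thesis by (simp add: algebra_simps)
  qed
  finally have "exp (Re (\<i> * t * (iexp \<theta> * y)\<^sup>2 - (1 - \<i> * s) * (iexp \<theta> * y))) \<le> exp (s\<^sup>2 / (4 * t) - 1 / 2 * y)"
    by simp
  also have "\<dots> = exp (s\<^sup>2 / (4 * t)) * exp (- (1 / 2 * y))" by (simp add: exp_add[symmetric])
  finally have "y powr (\<alpha> - 1) * exp (Re (\<i> * t * (iexp \<theta> * y)\<^sup>2 - (1 - \<i> * s) * (iexp \<theta> * y)))
      \<le> y powr (\<alpha> - 1) * (exp (s\<^sup>2 / (4 * t)) * exp (- (1 / 2 * y)))"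
    by (intro mult_left_mono) auto
  moreover have "norm (rotated_kernel \<alpha> s t \<theta> y)
     = y powr (\<alpha> - 1) * exp (Re (\<i> * t * (iexp \<theta> * y)\<^sup>2 - (1 - \<i> * s) * (iexp \<theta> * y)))"
    unfolding rotated_kernel_def norm_mult norm_exp_eq_Re by simp
  ultimately show ?thesis by (simp only: mult_ac)
qed

text \<open>
  Cauchy's theorem for a sector whose vertex is the branch point $0$, obtained without contours: the kernel satisfies
  $\partial_\theta \Phi = i\,\partial_y (y\Phi)$. Integrating over $\theta$ and exchanging the integrals
  by Fubini leaves the total $y$-derivative of $y\Phi$, which vanishes at both ends of the half line.
\<close>

lemma rotated_kernel_integral_eq:
  assumes "\<alpha> > 0" "t > 0"
  shows "(LBINT y:{0<..}. rotated_kernel \<alpha> s t (pi / 4) y) = (LBINT y:{0<..}. rotated_kernel \<alpha> s t 0 y)"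
proof -
  define \<Phi> where "\<Phi> = rotated_kernel \<alpha> s t"
  \<comment> \<open>The derivative of \<open>y * \<Phi> \<theta> y\<close> with respect to \<open>y\<close>; times the imaginary unit, it is the derivative of \<open>\<Phi> \<theta> y\<close> with respect to \<open>\<theta>\<close>.\<close>
  define D where "D = (\<lambda>\<theta> y. (\<alpha> + iexp \<theta> * y * (2 * \<i> * t * iexp \<theta> * y - (1 - \<i> * s))) * \<Phi> \<theta> y)"
  define w where "w = (\<lambda>y. exp (s\<^sup>2 / (4 * t)) *
     (\<alpha> * (y powr (\<alpha> - 1) * exp (- (1 / 2 * y))) + 2 * t * (y powr (\<alpha> + 2 - 1) * exp (- (1 / 2 * y)))
        + norm (1 - \<i> * s) * (y powr (\<alpha> + 1 - 1) * exp (- (1 / 2 * y)))))"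
  have w_int: "integrable lborel (\<lambda>y. indicator {0<..} y * w y)"
  proof -
    have "integrable lborel (\<lambda>y. exp (s\<^sup>2 / (4 * t)) *
     (\<alpha> * (indicator {0<..} y * (y powr (\<alpha> - 1) * exp (- (1 / 2 * y)))) + 2 * t * (indicator {0<..} y * (y powr (\<alpha> + 2 - 1) * exp (- (1 / 2 * y))))
        + norm (1 - \<i> * s) * (indicator {0<..} y * (y powr (\<alpha> + 1 - 1) * exp (- (1 / 2 * y))))))"
      using gamma_integral[of \<alpha> "1/2"] gamma_integral[of "\<alpha> + 2" "1/2"] gamma_integral[of "\<alpha> + 1" "1/2"] assms
      by (intro integrable_mult_right Bochner_Integration.integrable_add) (auto simp: has_bochner_integral_iff)
    then show ?thesis by (rule back_subst[of "integrable lborel"]) (auto simp: w_def indicator_def)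
  qed
  have D_bound: "norm (D \<theta> y) \<le> w y" if "0 \<le> \<theta>" "\<theta> \<le> pi / 4" "y > 0" for \<theta> y
  proof -
    have "norm (\<alpha> + iexp \<theta> * y * (2 * \<i> * t * iexp \<theta> * y - (1 - \<i> * s)))
       \<le> norm (complex_of_real \<alpha>) + norm (iexp \<theta> * y * (2 * \<i> * t * iexp \<theta> * y)) + norm (iexp \<theta> * y * (1 - \<i> * s))"
      unfolding right_diff_distrib add_diff_eq by norm
    also have "\<dots> = \<alpha> + 2 * t * y\<^sup>2 + norm (1 - \<i> * s) * y"
      using assms that by (simp add: norm_mult power2_eq_square)
    finally have "norm (D \<theta> y) \<le> (\<alpha> + 2 * t * y\<^sup>2 + norm (1 - \<i> * s) * y) *
        (exp (s\<^sup>2 / (4 * t)) * (y powr (\<alpha> - 1) * exp (- (1 / 2 * y))))"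
      unfolding D_def norm_mult \<Phi>_def
      by (intro mult_mono rotated_kernel_bound that assms) (use assms that in \<open>auto intro!: add_nonneg_nonneg\<close>)
    also have "\<dots> = w y"
    proof -
      have "y powr (\<alpha> + 2 - 1) = y powr (\<alpha> - 1) * y\<^sup>2" "y powr (\<alpha> + 1 - 1) = y powr (\<alpha> - 1) * y"
        using that powr_add[of y "\<alpha> - 1" 2] powr_add[of y "\<alpha> - 1" 1] by (simp_all add: powr_numeral algebra_simps)
      then show ?thesis unfolding w_def by (simp only:) (simp add: algebra_simps)
    qed
    finally show ?thesis .
  qed
  have [measurable]: "(\<lambda>x. D (fst x) (snd x)) \<in> borel_measurable (borel \<Otimes>\<^sub>M borel)"
    "\<And>\<theta>. \<Phi> \<theta> \<in> borel_measurable borel"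
    unfolding D_def \<Phi>_def rotated_kernel_def by measurable
  define k where "k = (\<lambda>(\<theta>, y). indicator {0..pi/4} \<theta> *\<^sub>R (indicator {0<..} y *\<^sub>R D \<theta> y))"
  have k_int: "integrable (lborel \<Otimes>\<^sub>M lborel) k"
  proof (rule Bochner_Integration.integrable_bound)
    define b :: "real \<times> real \<Rightarrow> real" where "b = (\<lambda>(\<theta>, y). indicator {0..pi/4} \<theta> * (indicator {0<..} y * w y))"
    show "integrable (lborel \<Otimes>\<^sub>M lborel) b"
    proof (rule lborel_pair.Fubini_integrable)
      have [measurable]: "w \<in> borel_measurable borel" unfolding w_def by measurable
      show "b \<in> borel_measurable (lborel \<Otimes>\<^sub>M lborel)" unfolding b_def by measurable
      have "(LBINT y. norm (b (\<theta>, y))) = indicator {0..pi/4} \<theta> * (LBINT y. norm (indicator {0<..} y * w y))" for \<theta>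
        by (simp add: b_def abs_mult flip: integral_mult_right_zero)
      then show "integrable lborel (\<lambda>\<theta>. LBINT y. norm (b (\<theta>, y)))"
        by simp
    qed (use w_int in \<open>auto simp: b_def\<close>)
    show "k \<in> borel_measurable (lborel \<Otimes>\<^sub>M lborel)" unfolding k_def by measurable
    show "AE x in lborel \<Otimes>\<^sub>M lborel. norm (k x) \<le> norm (b x)"
      using D_bound by (intro AE_I2) (auto simp: k_def b_def indicator_def intro: order_trans[OF _ abs_ge_self])
  qed
  have \<Phi>_cont: "isCont (\<Phi> \<theta>) y" if "y > 0" for \<theta> y
    unfolding \<Phi>_def rotated_kernel_def using that by (intro continuous_intros) auto
  have dtheta: "((\<lambda>\<theta>. \<Phi> \<theta> y) has_vector_derivative (\<i> * D \<theta> y)) (at \<theta>)" for \<theta> y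
  proof -
    define c where "c = complex_of_real (y powr (\<alpha> - 1))"
    have "((\<lambda>z. exp (\<i> * (\<alpha> * z)) * c * exp (\<i> * t * (exp (\<i> * z) * y)\<^sup>2 - (1 - \<i> * s) * (exp (\<i> * z) * y)))
        has_field_derivative \<i> * ((\<alpha> + exp (\<i> * z) * y * (2 * \<i> * t * exp (\<i> * z) * y - (1 - \<i> * s))) *
          (exp (\<i> * (\<alpha> * z)) * c * exp (\<i> * t * (exp (\<i> * z) * y)\<^sup>2 - (1 - \<i> * s) * (exp (\<i> * z) * y))))) (at z)" for z
      by (rule derivative_eq_intros refl | simp)+ (simp add: power2_eq_square algebra_simps)
    from has_vector_derivative_real_field[OF this] show ?thesis
      unfolding \<Phi>_def D_def rotated_kernel_def c_def by simp
  qed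
  have dy: "((\<lambda>y. y * \<Phi> \<theta> y) has_vector_derivative D \<theta> y) (at y)" if "y > 0" for \<theta> y
  proof -
    have d1: "((\<lambda>y. complex_of_real (y powr (\<alpha> - 1))) has_vector_derivative
        complex_of_real ((\<alpha> - 1) * y powr (\<alpha> - 1) / y)) (at y)"
      using that has_real_derivative_powr[OF that, of "\<alpha> - 1"]
      by (intro has_vector_derivative_of_real) (simp add: powr_diff power2_eq_square has_real_derivative_iff_has_vector_derivative)
    have "((\<lambda>z. exp (\<i> * t * (iexp \<theta> * z)\<^sup>2 - (1 - \<i> * s) * (iexp \<theta> * z))) has_field_derivative
        (exp (\<i> * t * (iexp \<theta> * z)\<^sup>2 - (1 - \<i> * s) * (iexp \<theta> * z)) *
          (2 * \<i> * t * iexp \<theta> * iexp \<theta> * z - (1 - \<i> * s) * iexp \<theta>))) (at z)" for z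
      by (rule derivative_eq_intros refl | simp)+
    from has_vector_derivative_real_field[OF this]
    have d2: "((\<lambda>y. exp (\<i> * t * (iexp \<theta> * complex_of_real y)\<^sup>2 - (1 - \<i> * s) * (iexp \<theta> * complex_of_real y))) has_vector_derivative
        (exp (\<i> * t * (iexp \<theta> * complex_of_real y)\<^sup>2 - (1 - \<i> * s) * (iexp \<theta> * complex_of_real y)) *
          (2 * \<i> * t * iexp \<theta> * iexp \<theta> * y - (1 - \<i> * s) * iexp \<theta>))) (at y)" .
    note has_vector_derivative_mult[OF has_vector_derivative_of_real[OF DERIV_ident]
        has_vector_derivative_mult_right[OF has_vector_derivative_mult[OF d1 d2], of "iexp (\<alpha> * \<theta>)"]]
    then show ?thesis
      unfolding \<Phi>_def rotated_kernel_def D_def mult.assoc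
      by (rule has_vector_derivative_eq_rhs) (use that in \<open>simp add: field_simps\<close>)
  qed
  have \<Phi>_lim: "((\<lambda>y. y * \<Phi> \<theta> y) \<longlongrightarrow> 0) F" if "0 \<le> \<theta>" "\<theta> \<le> pi / 4" and F: "F = at_right 0 \<or> F = at_top" for F \<theta>
  proof (rule Lim_null_comparison)
    show "eventually (\<lambda>y. norm (y * \<Phi> \<theta> y) \<le> exp (s\<^sup>2 / (4 * t)) * (y * (y powr (\<alpha> - 1) * exp (- (1 / 2 * y))))) F"
    proof -
      have "eventually (\<lambda>y. y > 0) F" using F eventually_at_right_less[of "0::real"] eventually_gt_at_top[of "0::real"] by auto
      then show ?thesis
      proof eventually_elim
        case (elim y)
        then show ?case
          using mult_left_mono[OF rotated_kernel_bound[OF assms(2) that(1,2) elim, of \<alpha> s], of y]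
          by (simp add: norm_mult \<Phi>_def mult_ac)
      qed
    qed
    have "((\<lambda>y. y * (y powr (\<alpha> - 1) * exp (- (1 / 2 * y)))) \<longlongrightarrow> 0) (at_right 0)" using assms by real_asymp
    moreover have "((\<lambda>y. y * (y powr (\<alpha> - 1) * exp (- (1 / 2 * y)))) \<longlongrightarrow> 0) at_top" by real_asymp
    ultimately show "((\<lambda>y. exp (s\<^sup>2 / (4 * t)) * (y * (y powr (\<alpha> - 1) * exp (- (1 / 2 * y))))) \<longlongrightarrow> 0) F"
      using F by (intro tendsto_mult_right_zero) auto
  qed
  have D_cont: "isCont (D \<theta>) y" if "y > 0" for \<theta> y
    unfolding D_def by (intro continuous_intros \<Phi>_cont that)
  have D_int: "set_integrable lborel {0<..} (D \<theta>)" if "0 \<le> \<theta>" "\<theta> \<le> pi / 4" for \<theta>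
    unfolding set_integrable_def
  proof (rule Bochner_Integration.integrable_bound[OF w_int])
    show "(\<lambda>y. indicator {0<..} y *\<^sub>R D \<theta> y) \<in> borel_measurable lborel"
      by (auto simp: D_def)
  qed (use D_bound that in \<open>auto simp: indicator_def intro: order_trans[OF _ abs_ge_self]\<close>)
  have D0: "(LBINT y:{0<..}. D \<theta> y) = 0" if "0 \<le> \<theta>" "\<theta> \<le> pi / 4" for \<theta>
  proof -
    have "(LBINT y:{0<..}. D \<theta> y) = 0 - 0"
      by (rule FTC_half_line) (use dy D_cont D_int[OF that] \<Phi>_lim[OF that] in auto)
    then show ?thesis by simp
  qed
  have \<Phi>_int: "set_integrable lborel {0<..} (\<Phi> \<theta>)" if "0 \<le> \<theta>" "\<theta> \<le> pi / 4" for \<theta>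
    unfolding set_integrable_def
  proof (rule Bochner_Integration.integrable_bound)
    show "integrable lborel (\<lambda>y. exp (s\<^sup>2 / (4 * t)) * (indicator {0<..} y * (y powr (\<alpha> - 1) * exp (- (1 / 2 * y)))))"
      using gamma_integral[of \<alpha> "1/2"] assms by (intro integrable_mult_right) (auto simp: has_bochner_integral_iff)
    show "(\<lambda>y. indicator {0<..} y *\<^sub>R \<Phi> \<theta> y) \<in> borel_measurable lborel" by measurable
  qed (use rotated_kernel_bound[OF assms(2) that] in \<open>auto simp: indicator_def \<Phi>_def\<close>)
  have "(LBINT y:{0<..}. \<Phi> (pi / 4) y) - (LBINT y:{0<..}. \<Phi> 0 y) = (LBINT y:{0<..}. \<Phi> (pi / 4) y - \<Phi> 0 y)"
    using pi_ge_zero by (subst set_integral_diff(2)) (auto intro!: \<Phi>_int)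
  also have "\<dots> = (LBINT y. LBINT \<theta>. \<i> * k (\<theta>, y))"
    unfolding set_lebesgue_integral_def
  proof (rule Bochner_Integration.integral_cong[OF refl])
    fix y
    have "(LBINT \<theta>. indicator {0..pi/4} \<theta> *\<^sub>R (\<i> * D \<theta> y)) = \<Phi> (pi / 4) y - \<Phi> 0 y"
    proof (rule integral_FTC_atLeastAtMost)
      show "continuous_on {0..pi/4} (\<lambda>\<theta>. \<i> * D \<theta> y)"
        unfolding D_def \<Phi>_def rotated_kernel_def by (intro continuous_intros)
    qed (use pi_ge_zero dtheta in \<open>auto intro: has_vector_derivative_at_within\<close>)
    then have "indicator {0<..} y *\<^sub>R (\<Phi> (pi / 4) y - \<Phi> 0 y)
       = (LBINT \<theta>. indicator {0<..} y *\<^sub>R (indicator {0..pi/4} \<theta> *\<^sub>R (\<i> * D \<theta> y)))"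
      by (simp only: integral_scaleR_right)
    then show "indicator {0<..} y *\<^sub>R (\<Phi> (pi / 4) y - \<Phi> 0 y) = (LBINT \<theta>. \<i> * k (\<theta>, y))"
      by (simp add: k_def mult.commute[of "indicator {0<..} y"])
  qed
  also have "\<dots> = (LBINT \<theta>. LBINT y. \<i> * k (\<theta>, y))"
    using lborel_pair.Fubini_integral[of "\<lambda>\<theta> y. k (\<theta>, y)"] k_int by simp
  also have "\<dots> = 0"
  proof -
    have "(LBINT y. k (\<theta>, y)) = 0" for \<theta>
      using D0[of \<theta>] by (auto simp: k_def set_lebesgue_integral_def indicator_def)
    then show ?thesis by simp
  qed
  finally show ?thesis by (simp add: \<Phi>_def)
qed

section \<open>The function $\psi$ as an oscillatory integral, and its decay\<close>

text \<open>
  The substitution $u = \sqrt{2t}\,y$ in the integral that defines $D_{-\alpha}$. The exponential factor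
  $e^{-z^2/4}$ of $D_{-\alpha}$ cancels the one of $\psi$, and the principal power $(i/(2t))^{\alpha/2}$ supplies the constant
  $e^{i\pi\alpha/4}$ of the rotated ray.
\<close>

lemma psi_eq_rotated_kernel:
  assumes "\<alpha> > 0" "t > 0"
  shows "psi \<alpha> s t = (LBINT y:{0<..}. rotated_kernel \<alpha> s t (pi / 4) y) / Gamma \<alpha>"
proof -
  define r where "r = sqrt (2 * t)"
  have r: "r > 0" "r\<^sup>2 = 2 * t" using assms by (simp_all add: r_def)
  define e where "e = iexp (pi / 4)"
  have ec: "e = cis (pi / 4)" by (simp add: e_def cis_conv_exp)
  have e2: "e\<^sup>2 = \<i>"
  proof -
    have "e\<^sup>2 = cis (real 2 * (pi / 4))" unfolding ec by (rule Complex.DeMoivre)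
    also have "real 2 * (pi / 4) = pi / 2" by simp
    finally show ?thesis by simp
  qed
  have sq: "csqrt \<i> = e"
    by (rule csqrt_unique[OF e2]) (simp add: ec cos_45)
  define z where "z = csqrt \<i> * ((1 - \<i> * s) / r)"
  define f where "f = (\<lambda>u. indicator {0<..} u *\<^sub>R (complex_of_real (u powr (\<alpha> - 1)) * exp (- (complex_of_real u)\<^sup>2 / 2 - z * u)))"
  have cancel: "exp (\<i> * (1 - \<i> * s)\<^sup>2 / complex_of_real (8 * t)) * exp (- z\<^sup>2 / 4) = 1"
  proof -
    have "z\<^sup>2 = \<i> * (1 - \<i> * s)\<^sup>2 / complex_of_real (2 * t)"
      unfolding z_def sq power_mult_distrib power_divide e2 of_real_power[symmetric] r(2) by simp
    then show ?thesis by (simp add: exp_add[symmetric])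
  qed
  have pw: "(\<i> / complex_of_real (2 * t)) powr complex_of_real (\<alpha> / 2) = iexp (\<alpha> * (pi / 4)) / r powr \<alpha>"
  proof -
    have "Ln (\<i> / complex_of_real (2 * t)) = Ln (complex_of_real (1 / (2 * t)) * \<i>)" by simp
    also have "\<dots> = complex_of_real (ln (1 / (2 * t))) + Ln \<i>"
      using assms by (subst Ln_times_of_real) (auto simp: Ln_of_real simp del: of_real_divide)
    also have "ln (1 / (2 * t)) = - 2 * ln r"
      using assms by (simp add: r_def ln_sqrt ln_div)
    finally have L: "Ln (\<i> / complex_of_real (2 * t)) = complex_of_real (- 2 * ln r) + \<i> * complex_of_real pi / 2"
      by simp
    have "(\<i> / complex_of_real (2 * t)) powr complex_of_real (\<alpha> / 2)
        = exp (complex_of_real (\<alpha> / 2) * Ln (\<i> / complex_of_real (2 * t)))"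
      using assms by (simp add: powr_def)
    also have "complex_of_real (\<alpha> / 2) * Ln (\<i> / complex_of_real (2 * t)) = \<i> * (\<alpha> * (pi / 4)) - complex_of_real (\<alpha> * ln r)"
      unfolding L by (simp add: algebra_simps)
    finally have "(\<i> / complex_of_real (2 * t)) powr complex_of_real (\<alpha> / 2)
        = exp (\<i> * (\<alpha> * (pi / 4)) - complex_of_real (\<alpha> * ln r))" .
    then show ?thesis using r by (simp add: exp_diff powr_def exp_of_real[symmetric])
  qed
  have "(LBINT u:{0<..}. complex_of_real (u powr (\<alpha> - 1)) * exp (- (complex_of_real u)\<^sup>2 / 2 - z * u)) = integral\<^sup>L lborel f"
    by (simp add: f_def set_lebesgue_integral_def)
  also have "\<dots> = \<bar>r\<bar> *\<^sub>R (LBINT y. f (0 + r * y))"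
    using r by (intro lborel_integral_real_affine) auto
  also have "\<dots> = (LBINT y. complex_of_real r * f (0 + r * y))"
    unfolding integral_mult_right_zero using r by (simp add: scaleR_conv_of_real)
  also have "\<dots> = (LBINT y. (complex_of_real (r powr \<alpha>) / iexp (\<alpha> * (pi / 4))) * (indicator {0<..} y *\<^sub>R rotated_kernel \<alpha> s t (pi / 4) y))"
  proof (rule Bochner_Integration.integral_cong[OF refl])
    fix y
    show "complex_of_real r * f (0 + r * y)
       = (complex_of_real (r powr \<alpha>) / iexp (\<alpha> * (pi / 4))) * (indicator {0<..} y *\<^sub>R rotated_kernel \<alpha> s t (pi / 4) y)"
    proof (cases "y > 0")
      case True
      have "r * (r * y) powr (\<alpha> - 1) = r powr \<alpha> * y powr (\<alpha> - 1)"
        using r True by (simp add: powr_mult powr_diff)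
      then have 1: "complex_of_real r * complex_of_real ((r * y) powr (\<alpha> - 1)) = complex_of_real (r powr \<alpha>) * complex_of_real (y powr (\<alpha> - 1))"
        by (metis of_real_mult)
      have "- (complex_of_real (r * y))\<^sup>2 / 2 - z * complex_of_real (r * y) = \<i> * t * (e * y)\<^sup>2 - (1 - \<i> * s) * (e * y)"
      proof -
        have "(complex_of_real (r * y))\<^sup>2 = complex_of_real (2 * t) * (complex_of_real y)\<^sup>2"
          unfolding of_real_mult power_mult_distrib of_real_power[symmetric] r(2) by simp
        moreover have "(e * y)\<^sup>2 = \<i> * (complex_of_real y)\<^sup>2" by (simp add: power_mult_distrib e2)
        moreover have "z * complex_of_real (r * y) = (1 - \<i> * s) * (e * y)"
          unfolding z_def sq using r by simp
        moreover have "\<i> * t * (\<i> * (complex_of_real y)\<^sup>2) = (\<i> * \<i>) * (t * (complex_of_real y)\<^sup>2)"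
          by (simp only: mult_ac)
        ultimately show ?thesis by (simp only:) simp
      qed
      then show ?thesis using True r 1
        by (simp add: f_def rotated_kernel_def e_def mult.assoc[symmetric] zero_less_mult_iff)
    qed (use r in \<open>simp add: f_def zero_less_mult_iff\<close>)
  qed
  also have "\<dots> = (complex_of_real (r powr \<alpha>) / iexp (\<alpha> * (pi / 4))) * (LBINT y:{0<..}. rotated_kernel \<alpha> s t (pi / 4) y)"
    unfolding set_lebesgue_integral_def by (rule integral_mult_right_zero)
  finally have I: "(LBINT u:{0<..}. complex_of_real (u powr (\<alpha> - 1)) * exp (- (complex_of_real u)\<^sup>2 / 2 - z * u)) = \<dots>" .
  have "psi \<alpha> s t = (\<i> / complex_of_real (2 * t)) powr complex_of_real (\<alpha> / 2) *
      (exp (\<i> * (1 - \<i> * s)\<^sup>2 / complex_of_real (8 * t)) * exp (- z\<^sup>2 / 4)) / Gamma \<alpha> *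
     (LBINT u:{0<..}. complex_of_real (u powr (\<alpha> - 1)) * exp (- (complex_of_real u)\<^sup>2 / 2 - z * u))"
    by (simp add: psi_def parabolic_cylinder_D_def z_def r_def)
  also have "\<dots> = (LBINT y:{0<..}. rotated_kernel \<alpha> s t (pi / 4) y) / Gamma \<alpha>"
    unfolding cancel pw I using r by simp
  finally show ?thesis .
qed

lemma psi_eq:
  assumes "\<alpha> > 0" "t > 0"
  shows "psi \<alpha> s t = (LBINT y:{0<..}. complex_of_real (y powr (\<alpha> - 1)) * exp (\<i> * t * y\<^sup>2 - (1 - \<i> * s) * y)) / Gamma \<alpha>"
  unfolding psi_eq_rotated_kernel[OF assms] rotated_kernel_integral_eq[OF assms]
  by (simp add: rotated_kernel_def[abs_def])

text \<open>
  The integral of $y^{\alpha-1}e^{it y^2-py}$ with $p = 1-is$ is split at $\delta = 1/|p|$. On $(0,\delta]$ the singularity at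
  $0$ contributes at most $\delta^\alpha/\alpha$. On $(\delta,\infty)$ one integration by parts gains the
  factor $1/|p|$ and leaves the boundary term $\delta^{\alpha-1}$ and integrals that are bounded or again of
  order $\delta^{\alpha-1}$. For $\alpha > 1$ a single integration by parts gives no more than the exponent $1$, whence the
  minimum.
\<close>

lemma psi_decay:
  assumes "\<alpha> > 0" "t > 0"
  obtains C where "\<And>s::real. norm (psi \<alpha> s t) \<le> C * norm (1 - \<i> * s) powr (- min \<alpha> 1)"
proof -
  define a where "a = min \<alpha> 1"
  define C where "C = 1 / \<alpha> + (2 + Gamma \<alpha> + 2 * t * Gamma (\<alpha> + 1))"
  have Gpos: "Gamma \<alpha> > 0" "Gamma (\<alpha> + 1) > 0" using assms by simp_all
  have main: "norm (LBINT y:{0<..}. complex_of_real (y powr (\<alpha> - 1)) * exp (\<i> * t * y\<^sup>2 - (1 - \<i> * s) * y))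
       \<le> C * norm (1 - \<i> * s) powr (- a)" for s :: real
  proof -
    define p where "p = 1 - \<i> * complex_of_real s"
    define \<delta> where "\<delta> = 1 / norm p"
    have "Re p \<le> norm p" by (rule complex_Re_le_cmod)
    then have p1: "norm p \<ge> 1" by (simp add: p_def)
    then have pn: "p \<noteq> 0" by auto
    have \<delta>: "\<delta> > 0" "\<delta> \<le> 1" using p1 by (auto simp: \<delta>_def divide_simps)
    define e where "e = (\<lambda>y::real. exp (\<i> * t * (complex_of_real y)\<^sup>2 - p * y))"
    have ne: "norm (e y) = exp (- y)" for y
      by (simp add: e_def p_def power2_eq_square flip: of_real_mult)
    have [measurable]: "e \<in> borel_measurable borel" unfolding e_def by measurable
    define F where "F = (\<lambda>y. complex_of_real (y powr (\<alpha> - 1)) * e y)"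
    have nF: "norm (F y) = y powr (\<alpha> - 1) * exp (- y)" for y by (simp add: F_def norm_mult ne)
    have [measurable]: "F \<in> borel_measurable borel" unfolding F_def by measurable
    define g where "g = (\<lambda>y. complex_of_real ((\<alpha> - 1) * y powr (\<alpha> - 2)) * e y)"
    have ng: "norm (g y) = \<bar>\<alpha> - 1\<bar> * y powr (\<alpha> - 2) * exp (- y)" for y unfolding g_def norm_mult norm_of_real ne abs_mult by simp
    have [measurable]: "g \<in> borel_measurable borel" unfolding g_def by measurable
    have gi: "set_integrable lborel {0<..} (\<lambda>y. y powr (b - 1) * exp (- y))"
      "(LBINT y:{0<..}. y powr (b - 1) * exp (- y)) = Gamma b" if "b > 0" for b :: real
      using gamma_integral[OF that zero_less_one] unfolding set_integrable_def set_lebesgue_integral_def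
      by (auto simp: has_bochner_integral_iff)
    have F_int: "set_integrable lborel {0<..} F"
      by (rule set_integrable_bound[OF gi(1)[OF assms(1)]]) (auto simp: nF set_borel_measurable_def)
    have yF: "norm (y * F y) = y powr ((\<alpha> + 1) - 1) * exp (- y)" if "y > 0" for y
      using that by (simp add: norm_mult nF powr_diff)
    have yF_int: "set_integrable lborel {0<..} (\<lambda>y. y * F y)"
      by (rule set_integrable_bound[OF gi(1)[of "\<alpha> + 1"]])
         (use yF assms in \<open>auto simp: set_borel_measurable_def\<close>)
    have g_int: "set_integrable lborel {\<delta><..} g"
    proof (rule set_integrable_bound)
      show "set_integrable lborel {\<delta><..} (\<lambda>y. \<bar>\<alpha> - 1\<bar> / \<delta> * (y powr (\<alpha> - 1) * exp (- y)))"
        using \<delta> by (intro set_integrable_mult_right set_integrable_subset[OF gi(1)[OF assms(1)]]) auto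
      show "AE y in lborel. y \<in> {\<delta><..} \<longrightarrow> norm (g y) \<le> norm (\<bar>\<alpha> - 1\<bar> / \<delta> * (y powr (\<alpha> - 1) * exp (- y)))"
      proof (intro AE_I2 impI)
        fix y assume "y \<in> {\<delta><..}"
        then have y: "y > \<delta>" "y > 0" using \<delta> by auto
        have "y powr (\<alpha> - 2) = y powr (\<alpha> - 1) / y" using y by (simp add: powr_diff power2_eq_square powr_numeral)
        also have "\<dots> \<le> y powr (\<alpha> - 1) / \<delta>" using y \<delta> by (intro divide_left_mono) auto
        finally have "\<bar>\<alpha> - 1\<bar> * y powr (\<alpha> - 2) * exp (- y) \<le> \<bar>\<alpha> - 1\<bar> * (y powr (\<alpha> - 1) / \<delta>) * exp (- y)"
          by (intro mult_left_mono mult_right_mono) auto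
        then show "norm (g y) \<le> norm (\<bar>\<alpha> - 1\<bar> / \<delta> * (y powr (\<alpha> - 1) * exp (- y)))"
          using \<delta> by (simp add: ng abs_mult)
      qed
    qed (auto simp: set_borel_measurable_def)
    have head: "norm (LBINT y:{0<..\<delta>}. F y) \<le> \<delta> powr \<alpha> / \<alpha>"
    proof -
      have "((\<lambda>y. y powr (\<alpha> - 1)) has_integral (\<delta> powr \<alpha> / \<alpha>)) {0..\<delta>}"
        using has_integral_powr_from_0[of "\<alpha> - 1" \<delta>] assms \<delta> by simp
      then have "(\<integral>\<^sup>+y. ennreal (indicator {0..\<delta>} y * y powr (\<alpha> - 1)) \<partial>lborel) = ennreal (\<delta> powr \<alpha> / \<alpha>)"
        using nn_integral_has_integral_lebesgue[of "{0..\<delta>}" "\<lambda>y. y powr (\<alpha> - 1)"] by simp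
      then have h: "has_bochner_integral lborel (\<lambda>y. indicator {0..\<delta>} y * y powr (\<alpha> - 1)) (\<delta> powr \<alpha> / \<alpha>)"
        using assms by (intro has_bochner_integral_nn_integral) (auto intro: divide_nonneg_pos)
      have "norm (LBINT y:{0<..\<delta>}. F y) \<le> (LBINT y. indicator {0..\<delta>} y * y powr (\<alpha> - 1))"
        unfolding set_lebesgue_integral_def
      proof (rule Bochner_Integration.integral_norm_bound_integral)
        show "integrable lborel (\<lambda>y. indicator {0<..\<delta>} y *\<^sub>R F y)"
          using set_integrable_subset[OF F_int, of "{0<..\<delta>}"] by (simp add: set_integrable_def subset_iff)
      qed (use h in \<open>auto simp: has_bochner_integral_iff nF indicator_def mult_left_le\<close>)
      then show ?thesis using h by (simp add: has_bochner_integral_iff)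
    qed
    have g_bound: "norm (LBINT y:{\<delta><..}. g y) \<le> \<delta> powr (\<alpha> - 1) + Gamma \<alpha>"
    proof (cases "\<alpha> > 1")
      case True
      have *: "y powr (\<alpha> - 2) = y powr ((\<alpha> - 1) - 1)" for y by simp
      have "norm (LBINT y:{\<delta><..}. g y) \<le> (LBINT y. (\<alpha> - 1) * (indicator {0<..} y * (y powr ((\<alpha> - 1) - 1) * exp (- y))))"
        unfolding set_lebesgue_integral_def
      proof (rule Bochner_Integration.integral_norm_bound_integral)
        show "integrable lborel (\<lambda>y. indicator {\<delta><..} y *\<^sub>R g y)"
          using g_int by (simp add: set_integrable_def)
        show "integrable lborel (\<lambda>y. (\<alpha> - 1) * (indicator {0<..} y * (y powr ((\<alpha> - 1) - 1) * exp (- y))))"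
          using gi(1)[of "\<alpha> - 1"] True by (intro integrable_mult_right) (simp add: set_integrable_def)
        show "norm (indicator {\<delta><..} y *\<^sub>R g y) \<le> (\<alpha> - 1) * (indicator {0<..} y * (y powr ((\<alpha> - 1) - 1) * exp (- y)))" for y
          unfolding *[symmetric] using True \<delta> by (auto simp: indicator_def ng)
      qed
      also have "\<dots> = (\<alpha> - 1) * Gamma (\<alpha> - 1)"
        using gi(2)[of "\<alpha> - 1"] True unfolding integral_mult_right_zero by (simp add: set_lebesgue_integral_def)
      also have "\<dots> = Gamma \<alpha>"
      proof -
        have "\<alpha> - 1 \<notin> \<int>\<^sub>\<le>\<^sub>0"
        proof
          assume "\<alpha> - 1 \<in> \<int>\<^sub>\<le>\<^sub>0"
          then obtain k where "\<alpha> - 1 = of_int k" "k \<le> 0" by (elim nonpos_Ints_cases)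
          moreover from this have "real_of_int k \<le> 0" by simp
          ultimately show False using True by linarith
        qed
        then show ?thesis using Gamma_plus1[of "\<alpha> - 1"] by simp
      qed
      finally show ?thesis using powr_ge_zero[of \<delta> "\<alpha> - 1"] by linarith
    next
      case False
      show ?thesis
      proof (cases "\<alpha> = 1")
        case True
        then show ?thesis using Gpos by (simp add: g_def)
      next
        case a: False
        have "(\<integral>\<^sup>+y. ennreal ((1 - \<alpha>) * y powr (\<alpha> - 2)) * indicator {\<delta>..} y \<partial>lborel) = ennreal (0 - (- (\<delta> powr (\<alpha> - 1))))"
        proof (rule nn_integral_FTC_atLeast)
          fix y assume y: "\<delta> \<le> y"
          then show "((\<lambda>y. - (y powr (\<alpha> - 1))) has_real_derivative (1 - \<alpha>) * y powr (\<alpha> - 2)) (at y)"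
            using \<delta> by (auto intro!: derivative_eq_intros simp: algebra_simps)
        next
          have "\<alpha> - 1 < 0" using False a by simp
          then show "((\<lambda>y. - (y powr (\<alpha> - 1))) \<longlongrightarrow> 0) at_top" by real_asymp
        qed (use False in auto)
        then have "(\<integral>\<^sup>+y. ennreal (indicator {\<delta>..} y * ((1 - \<alpha>) * y powr (\<alpha> - 2))) \<partial>lborel) = ennreal (\<delta> powr (\<alpha> - 1))"
          by (simp add: ennreal_mult' ennreal_indicator mult.commute)
        then have h: "has_bochner_integral lborel (\<lambda>y. indicator {\<delta>..} y * ((1 - \<alpha>) * y powr (\<alpha> - 2))) (\<delta> powr (\<alpha> - 1))"
          using False by (intro has_bochner_integral_nn_integral) auto
        have "norm (LBINT y:{\<delta><..}. g y) \<le> (LBINT y. indicator {\<delta>..} y * ((1 - \<alpha>) * y powr (\<alpha> - 2)))"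
          unfolding set_lebesgue_integral_def
        proof (rule Bochner_Integration.integral_norm_bound_integral)
          show "integrable lborel (\<lambda>y. indicator {\<delta><..} y *\<^sub>R g y)"
            using g_int by (simp add: set_integrable_def)
        qed (use h False \<delta> in \<open>auto simp: has_bochner_integral_iff ng indicator_def intro!: mult_left_le\<close>)
        then show ?thesis using h Gpos by (simp add: has_bochner_integral_iff)
      qed
    qed
    \<comment> \<open>The integrand is the derivative of \<open>F\<close>, so this is the integration by parts in disguise.\<close>
    have FTC: "(LBINT y:{\<delta><..}. g y + (2 * \<i> * t * (y * F y) - p * F y)) = 0 - F \<delta>"
    proof (rule FTC_half_line)
      fix y assume "\<delta> < y"
      then have y: "y > 0" using \<delta> by simp
      show c: "isCont (\<lambda>y. g y + (2 * \<i> * t * (y * F y) - p * F y)) y"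
        unfolding g_def F_def e_def using y by (intro continuous_intros) auto
      have "((\<lambda>y. complex_of_real (y powr (\<alpha> - 1))) has_vector_derivative
          complex_of_real ((\<alpha> - 1) * y powr (\<alpha> - 2))) (at y)"
        using y by (intro has_vector_derivative_of_real) (auto intro!: derivative_eq_intros)
      moreover have "((\<lambda>z. exp (\<i> * t * z\<^sup>2 - p * z)) has_field_derivative exp (\<i> * t * z\<^sup>2 - p * z) * (2 * \<i> * t * z - p)) (at z)" for z
        by (rule derivative_eq_intros refl | simp)+
      from has_vector_derivative_real_field[OF this]
      have "(e has_vector_derivative e y * (2 * \<i> * t * y - p)) (at y)" unfolding e_def .
      ultimately show "(F has_vector_derivative g y + (2 * \<i> * t * (y * F y) - p * F y)) (at y)"
        unfolding F_def g_def
        by (rule has_vector_derivative_eq_rhs[OF has_vector_derivative_mult]) (simp add: algebra_simps)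
    next
      show "set_integrable lborel {\<delta><..} (\<lambda>y. g y + (2 * \<i> * t * (y * F y) - p * F y))"
        using \<delta> by (intro set_integral_add(1) set_integral_diff(1) set_integrable_mult_right g_int
          set_integrable_subset[OF F_int] set_integrable_subset[OF yF_int]) auto
      have "isCont F \<delta>" unfolding F_def e_def using \<delta> by (intro continuous_intros) auto
      then show "(F \<longlongrightarrow> F \<delta>) (at_right \<delta>)"
        by (simp add: continuous_within filterlim_at_split)
      show "(F \<longlongrightarrow> 0) at_top"
      proof (rule Lim_null_comparison)
        show "((\<lambda>y. y powr (\<alpha> - 1) * exp (- y)) \<longlongrightarrow> 0) at_top" by real_asymp
      qed (simp add: nF)
    qed
    have sub: "{\<delta><..} \<subseteq> {0<..}" using \<delta> by auto
    note ints = g_int set_integrable_subset[OF F_int _ sub] set_integrable_subset[OF yF_int _ sub]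
    have "(LBINT y:{\<delta><..}. g y + (2 * \<i> * t * (y * F y) - p * F y))
       = (LBINT y:{\<delta><..}. g y) + (2 * \<i> * t * (LBINT y:{\<delta><..}. y * F y) - p * (LBINT y:{\<delta><..}. F y))"
      using ints by (simp add: set_integral_add(2) set_integral_diff(2) set_integral_mult_right)
    with FTC have eq: "p * (LBINT y:{\<delta><..}. F y) = F \<delta> + (LBINT y:{\<delta><..}. g y) + 2 * \<i> * t * (LBINT y:{\<delta><..}. y * F y)"
      by (simp add: algebra_simps)
    have yF_bound: "norm (LBINT y:{\<delta><..}. y * F y) \<le> Gamma (\<alpha> + 1)"
    proof -
      have "norm (LBINT y:{\<delta><..}. y * F y) \<le> (LBINT y:{0<..}. y powr ((\<alpha> + 1) - 1) * exp (- y))"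
        unfolding set_lebesgue_integral_def
      proof (rule Bochner_Integration.integral_norm_bound_integral)
        show "norm (indicator {\<delta><..} y *\<^sub>R (y * F y)) \<le> indicator {0<..} y *\<^sub>R (y powr ((\<alpha> + 1) - 1) * exp (- y))" for y
          using yF[of y] \<delta> by (auto simp: indicator_def)
      qed (use ints(3) gi(1)[of "\<alpha> + 1"] assms in \<open>auto simp: set_integrable_def\<close>)
      then show ?thesis using gi(2)[of "\<alpha> + 1"] assms by simp
    qed
    have "norm (F \<delta>) \<le> \<delta> powr (\<alpha> - 1)" using \<delta> by (simp add: nF mult_left_le)
    then have "norm (p * (LBINT y:{\<delta><..}. F y)) \<le> \<delta> powr (\<alpha> - 1) + (\<delta> powr (\<alpha> - 1) + Gamma \<alpha>) + 2 * t * Gamma (\<alpha> + 1)"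
      unfolding eq using g_bound yF_bound assms
      by (intro norm_triangle_le add_mono) (auto simp: norm_mult)
    also have "\<dots> \<le> \<delta> powr (a - 1) + (\<delta> powr (a - 1) + Gamma \<alpha> * \<delta> powr (a - 1)) + 2 * t * Gamma (\<alpha> + 1) * \<delta> powr (a - 1)"
    proof -
      have "\<delta> powr (\<alpha> - 1) \<le> \<delta> powr (a - 1)" using \<delta> by (intro powr_mono') (auto simp: a_def)
      moreover have "1 \<le> \<delta> powr (a - 1)"
        using powr_mono'[of "a - 1" 0 \<delta>] \<delta> by (auto simp: a_def)
      ultimately show ?thesis using Gpos assms
        by (intro add_mono) (auto simp: mult_left_le_imp_le intro: order_trans[OF _ mult_left_mono])
    qed
    also have "\<dots> = (2 + Gamma \<alpha> + 2 * t * Gamma (\<alpha> + 1)) * \<delta> powr (a - 1)" by (simp add: algebra_simps)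
    finally have "\<delta> * norm (p * (LBINT y:{\<delta><..}. F y)) \<le> \<delta> * ((2 + Gamma \<alpha> + 2 * t * Gamma (\<alpha> + 1)) * \<delta> powr (a - 1))"
      using \<delta> by (intro mult_left_mono) auto
    then have tail: "norm (LBINT y:{\<delta><..}. F y) \<le> (2 + Gamma \<alpha> + 2 * t * Gamma (\<alpha> + 1)) * \<delta> powr a"
      using \<delta> pn by (simp add: norm_mult \<delta>_def[symmetric] powr_diff) (simp add: \<delta>_def)
    have "\<delta> powr \<alpha> / \<alpha> \<le> 1 / \<alpha> * \<delta> powr a"
      using assms \<delta> by (auto intro!: divide_right_mono powr_mono' simp: a_def)
    moreover have "(LBINT y:{0<..}. F y) = (LBINT y:{0<..\<delta>}. F y) + (LBINT y:{\<delta><..}. F y)"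
    proof -
      have "{0<..} = {0<..\<delta>} \<union> {\<delta><..}" using \<delta> by auto
      moreover have "(LBINT y:{0<..\<delta>} \<union> {\<delta><..}. F y) = (LBINT y:{0<..\<delta>}. F y) + (LBINT y:{\<delta><..}. F y)"
        using \<delta> by (intro set_integral_Un set_integrable_subset[OF F_int]) auto
      ultimately show ?thesis by simp
    qed
    ultimately have "norm (LBINT y:{0<..}. F y) \<le> C * \<delta> powr a"
      using head tail norm_triangle_ineq[of "LBINT y:{0<..\<delta>}. F y" "LBINT y:{\<delta><..}. F y"]
      by (simp add: C_def algebra_simps)
    also have "\<delta> powr a = norm p powr (- a)" using p1 by (simp add: \<delta>_def powr_divide powr_minus_divide)
    finally show ?thesis by (simp add: F_def e_def p_def)
  qed
  have "norm (psi \<alpha> s t) \<le> C / Gamma \<alpha> * norm (1 - \<i> * s) powr (- min \<alpha> 1)" for s :: real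
    using main[of s] Gpos by (simp add: psi_eq[OF assms] norm_divide divide_right_mono a_def)
  then show thesis by (rule that)
qed

section \<open>Scaling of products of gamma laws\<close>

definition gamma_measure :: "real \<Rightarrow> real measure" where
  "gamma_measure \<alpha> = density lborel (\<lambda>y. ennreal (gamma_density \<alpha> y))"

lemma sets_gamma_measure [simp, measurable_cong]: "sets (gamma_measure \<alpha>) = sets borel"
  by (simp add: gamma_measure_def)

lemma space_gamma_measure [simp]: "space (gamma_measure \<alpha>) = UNIV"
  by (simp add: gamma_measure_def)

lemma borel_measurable_gamma_density [measurable]: "gamma_density \<alpha> \<in> borel_measurable borel"
  unfolding gamma_density_def by measurable

lemma gamma_density_nonneg: "\<alpha> > 0 \<Longrightarrow> gamma_density \<alpha> y \<ge> 0"
  by (simp add: gamma_density_def)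

lemma prob_space_gamma_measure:
  assumes "\<alpha> > 0" shows "prob_space (gamma_measure \<alpha>)"
proof
  have "gamma_density \<alpha> = (\<lambda>y. inverse (Gamma \<alpha>) * (indicator {0<..} y * (y powr (\<alpha> - 1) * exp (- (1 * y)))))"
    by (auto simp: gamma_density_def)
  moreover have "has_bochner_integral lborel (\<lambda>y. inverse (Gamma \<alpha>) * (indicator {0<..} y * (y powr (\<alpha> - 1) * exp (- (1 * y)))))
      (inverse (Gamma \<alpha>) * (Gamma \<alpha> / 1 powr \<alpha>))"
    by (intro has_bochner_integral_mult_right gamma_integral assms) simp
  ultimately have "has_bochner_integral lborel (gamma_density \<alpha>) 1"
    using Gamma_real_pos[OF assms] by simp
  then have "(\<integral>\<^sup>+y. ennreal (gamma_density \<alpha> y) \<partial>lborel) = ennreal 1"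
    using gamma_density_nonneg[OF assms] by (subst nn_integral_eq_integral) (auto simp: has_bochner_integral_iff)
  then show "emeasure (gamma_measure \<alpha>) (space (gamma_measure \<alpha>)) = 1"
    by (simp add: gamma_measure_def emeasure_density)
qed

lemma AE_gamma_measure_pos: "AE y in gamma_measure \<alpha>. y > 0"
  unfolding gamma_measure_def by (subst AE_density) (auto simp: gamma_density_def)

text \<open>
  Scaling a gamma variable is the same as tilting its law by an exponential; for products this becomes the
  homogeneity from which the independence of sum and shape follows.
\<close>

lemma gamma_measure_scale:
  assumes "\<alpha> > 0" "r > 0"
  shows "distr (gamma_measure \<alpha>) borel ((*) r)
    = density (gamma_measure \<alpha>) (\<lambda>y. ennreal (r powr (- \<alpha>) * exp (y - y / r)))"
proof (rule measure_eqI)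
  fix A assume "A \<in> sets (distr (gamma_measure \<alpha>) borel ((*) r))"
  then have [measurable]: "A \<in> sets borel" by simp
  define h where "h = (\<lambda>x. ennreal (r powr (- \<alpha>) * exp (x - x / r) * gamma_density \<alpha> x) * indicator A x)"
  have [measurable]: "h \<in> borel_measurable borel" unfolding h_def by measurable
  have eq: "ennreal r * h (0 + r * y) = ennreal (gamma_density \<alpha> y) * indicator A (r * y)" for y
  proof -
    have "r * (r powr (- \<alpha>) * exp (r * y - r * y / r) * gamma_density \<alpha> (r * y)) = gamma_density \<alpha> y"
      using assms by (auto simp: gamma_density_def zero_less_mult_iff powr_mult powr_diff powr_minus exp_diff exp_minus field_simps)
    then show ?thesis using assms gamma_density_nonneg[OF assms(1)]
      by (simp add: h_def ennreal_mult[symmetric] mult.assoc[symmetric] del: mult.assoc)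
  qed
  have "emeasure (distr (gamma_measure \<alpha>) borel ((*) r)) A = (\<integral>\<^sup>+y. ennreal (gamma_density \<alpha> y) * indicator A (r * y) \<partial>lborel)"
  proof (subst emeasure_distr)
    have [measurable]: "(*) r -` A \<in> sets borel"
      using measurable_sets[of "(*) r" borel borel A] by simp
    show "emeasure (gamma_measure \<alpha>) ((*) r -` A \<inter> space (gamma_measure \<alpha>))
        = (\<integral>\<^sup>+y. ennreal (gamma_density \<alpha> y) * indicator A (r * y) \<partial>lborel)"
      by (auto simp: gamma_measure_def emeasure_density indicator_def intro!: nn_integral_cong)
  qed auto
  also have "\<dots> = ennreal r * (\<integral>\<^sup>+y. h (0 + r * y) \<partial>lborel)"
    unfolding eq[symmetric] by (rule nn_integral_cmult) auto
  also have "\<dots> = (\<integral>\<^sup>+x. h x \<partial>lborel)"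
    using assms by (subst nn_integral_real_affine[of h r 0]) auto
  also have "\<dots> = emeasure (density (gamma_measure \<alpha>) (\<lambda>y. ennreal (r powr (- \<alpha>) * exp (y - y / r)))) A"
    using gamma_density_nonneg[OF assms(1)]
    by (simp add: gamma_measure_def emeasure_density nn_integral_density h_def ennreal_mult mult_ac)
  finally show "emeasure (distr (gamma_measure \<alpha>) borel ((*) r)) A = \<dots>" .
qed simp

text \<open>
  Both the scaled and the tilted product law are products of the same one-dimensional laws, so they agree.
\<close>

lemma PiM_gamma_scale:
  fixes I :: "'i set"
  assumes "\<alpha> > 0" "r > 0" and I: "finite I"
  defines "P \<equiv> PiM I (\<lambda>_. gamma_measure \<alpha>)"
  assumes H[measurable]: "H \<in> borel_measurable (PiM I (\<lambda>_. borel))"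
  shows "(\<integral>\<^sup>+x. H (\<lambda>i\<in>I. r * x i) \<partial>P)
    = (\<integral>\<^sup>+x. ennreal (r powr (- (\<alpha> * card I)) * exp ((\<Sum>i\<in>I. x i) - (\<Sum>i\<in>I. x i) / r)) * H x \<partial>P)"
proof -
  define d where "d = (\<lambda>y. ennreal (r powr (- \<alpha>) * exp (y - y / r)))"
  have [measurable]: "d \<in> borel_measurable borel" unfolding d_def by measurable
  define \<gamma> where "\<gamma> = gamma_measure \<alpha>"
  have [measurable_cong, simp]: "sets \<gamma> = sets borel" by (simp add: \<gamma>_def)
  interpret \<gamma>: prob_space \<gamma> unfolding \<gamma>_def by (rule prob_space_gamma_measure[OF assms(1)])
  have scale: "distr \<gamma> borel ((*) r) = density \<gamma> d"
    unfolding \<gamma>_def d_def by (rule gamma_measure_scale[OF assms(1,2)])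
  interpret \<gamma>': prob_space "density \<gamma> d" unfolding scale[symmetric] by (rule \<gamma>.prob_space_distr) simp
  interpret G: product_sigma_finite "\<lambda>_::'i. \<gamma>" ..
  interpret G': product_sigma_finite "\<lambda>_::'i. density \<gamma> d" ..
  have P: "P = PiM I (\<lambda>_. \<gamma>)" by (simp add: P_def \<gamma>_def)
  have [measurable_cong, simp]: "sets P = sets (PiM I (\<lambda>_. borel))" unfolding P by (intro sets_PiM_cong) auto
  have spP: "space P = PiE I (\<lambda>_. UNIV)" by (simp add: P space_PiM \<gamma>_def)
  have 1: "distr P (PiM I (\<lambda>_. borel)) (\<lambda>x. \<lambda>i\<in>I. r * x i) = PiM I (\<lambda>_. density \<gamma> d)"
  proof (rule G'.PiM_eqI[OF I])
    fix A :: "'i \<Rightarrow> real set" assume "\<And>i. i \<in> I \<Longrightarrow> A i \<in> sets (density \<gamma> d)"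
    then have A[measurable]: "A i \<in> sets borel" if "i \<in> I" for i using that by simp
    have "emeasure (distr P (PiM I (\<lambda>_. borel)) (\<lambda>x. \<lambda>i\<in>I. r * x i)) (Pi\<^sub>E I A)
      = emeasure P ((\<lambda>x. \<lambda>i\<in>I. r * x i) -` Pi\<^sub>E I A \<inter> space P)"
      using I A by (intro emeasure_distr) (auto intro!: sets_PiM_I_finite)
    also have "(\<lambda>x. \<lambda>i\<in>I. r * x i) -` Pi\<^sub>E I A \<inter> space P = Pi\<^sub>E I (\<lambda>i. (*) r -` A i)"
      by (auto simp: spP PiE_iff)
    also have "emeasure P \<dots> = (\<Prod>i\<in>I. emeasure \<gamma> ((*) r -` A i))"
    proof -
      have "(*) r -` A i \<in> sets \<gamma>" if "i \<in> I" for i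
        using measurable_sets[of "(*) r" borel borel "A i"] A[OF that] by simp
      then show ?thesis unfolding P by (intro G.emeasure_PiM I)
    qed
    also have "\<dots> = (\<Prod>i\<in>I. emeasure (density \<gamma> d) (A i))"
      unfolding scale[symmetric] using A by (intro prod.cong refl, subst emeasure_distr) (auto simp: \<gamma>_def)
    finally show "emeasure (distr P (PiM I (\<lambda>_. borel)) (\<lambda>x. \<lambda>i\<in>I. r * x i)) (Pi\<^sub>E I A) = \<dots>" .
  qed (auto intro!: sets_PiM_cong)
  have 2: "density P (\<lambda>x. \<Prod>i\<in>I. d (x i)) = PiM I (\<lambda>_. density \<gamma> d)"
  proof (rule G'.PiM_eqI[OF I])
    fix A :: "'i \<Rightarrow> real set" assume "\<And>i. i \<in> I \<Longrightarrow> A i \<in> sets (density \<gamma> d)"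
    then have A[measurable]: "A i \<in> sets borel" if "i \<in> I" for i using that by simp
    have "emeasure (density P (\<lambda>x. \<Prod>i\<in>I. d (x i))) (Pi\<^sub>E I A) = (\<integral>\<^sup>+x. (\<Prod>i\<in>I. d (x i)) * indicator (Pi\<^sub>E I A) x \<partial>P)"
      using I A by (intro emeasure_density) (auto intro!: sets_PiM_I_finite)
    also have "\<dots> = (\<integral>\<^sup>+x. (\<Prod>i\<in>I. d (x i) * indicator (A i) (x i)) \<partial>P)"
    proof (rule nn_integral_cong)
      fix x assume "x \<in> space P"
      then have "indicator (Pi\<^sub>E I A) x = (\<Prod>i\<in>I. indicator (A i) (x i) :: ennreal)"
        using I by (auto simp: spP indicator_def PiE_iff prod_zero_iff)
      then show "(\<Prod>i\<in>I. d (x i)) * indicator (Pi\<^sub>E I A) x = (\<Prod>i\<in>I. d (x i) * indicator (A i) (x i))"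
        by (simp add: prod.distrib)
    qed
    also have "\<dots> = (\<Prod>i\<in>I. \<integral>\<^sup>+y. d y * indicator (A i) y \<partial>\<gamma>)"
      unfolding P by (intro G.product_nn_integral_prod I) (use A in measurable)
    also have "\<dots> = (\<Prod>i\<in>I. emeasure (density \<gamma> d) (A i))"
      using A by (intro prod.cong refl emeasure_density[symmetric]) auto
    finally show "emeasure (density P (\<lambda>x. \<Prod>i\<in>I. d (x i))) (Pi\<^sub>E I A) = \<dots>" .
  qed (auto intro!: sets_PiM_cong)
  have "(\<integral>\<^sup>+x. H (\<lambda>i\<in>I. r * x i) \<partial>P) = (\<integral>\<^sup>+x. H x \<partial>distr P (PiM I (\<lambda>_. borel)) (\<lambda>x. \<lambda>i\<in>I. r * x i))"
    by (subst nn_integral_distr) auto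
  also have "\<dots> = (\<integral>\<^sup>+x. (\<Prod>i\<in>I. d (x i)) * H x \<partial>P)"
    unfolding 1 2[symmetric] using I by (subst nn_integral_density) auto
  also have "(\<lambda>x. \<Prod>i\<in>I. d (x i)) = (\<lambda>x. ennreal (r powr (- (\<alpha> * card I)) * exp ((\<Sum>i\<in>I. x i) - (\<Sum>i\<in>I. x i) / r)))"
  proof
    fix x :: "'i \<Rightarrow> real"
    have "(\<Prod>i\<in>I. d (x i)) = ennreal (\<Prod>i\<in>I. r powr (- \<alpha>) * exp (x i - x i / r))"
      unfolding d_def by (rule prod_ennreal) simp
    also have "(\<Prod>i\<in>I. r powr (- \<alpha>) * exp (x i - x i / r)) = (r powr (- \<alpha>)) ^ card I * exp (\<Sum>i\<in>I. x i - x i / r)"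
      using I by (simp add: prod.distrib exp_sum)
    also have "(r powr (- \<alpha>)) ^ card I = r powr (- (\<alpha> * card I))"
      using assms by (simp add: powr_power mult.commute)
    finally show "(\<Prod>i\<in>I. d (x i)) = ennreal (r powr (- (\<alpha> * card I)) * exp ((\<Sum>i\<in>I. x i) - (\<Sum>i\<in>I. x i) / r))"
      by (simp add: sum_subtractf sum_divide_distrib)
  qed
  finally show ?thesis .
qed

section \<open>Independence of sum and shape\<close>

text \<open>
  Relates the measure $\beta r^{\beta-1}\,dr$, the radial part of a measure that is homogeneous of
  degree $\beta$, to the gamma density after the factor $e^{-r}$ is restored.
\<close>

lemma Gamma_mass_unit:
  assumes "\<beta> > 0"
  shows "ennreal (\<beta> * r powr (\<beta> - 1)) * ennreal (exp (- r)) * indicator {0<..} r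
     = ennreal (Gamma (\<beta> + 1)) * ennreal (gamma_density \<beta> r)"
proof -
  have "Gamma (\<beta> + 1) * inverse (Gamma \<beta>) = \<beta>"
  proof -
    have "\<beta> \<notin> \<int>\<^sub>\<le>\<^sub>0" using assms by (auto elim!: nonpos_Ints_cases)
    then show ?thesis using Gamma_plus1[of \<beta>] Gamma_real_pos[OF assms] by simp
  qed
  then have *: "\<beta> * r powr (\<beta> - 1) * exp (- r) = Gamma (\<beta> + 1) * (inverse (Gamma \<beta>) * exp (- r) * r powr (\<beta> - 1))"
    by (metis (no_types) mult.assoc mult.commute)
  show ?thesis
  proof (cases "r > 0")
    case True
    then show ?thesis using assms Gamma_real_pos[of "\<beta> + 1"] Gamma_real_pos[OF assms]
      by (simp add: gamma_density_def ennreal_mult[symmetric] *)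
  qed (simp add: gamma_density_def)
qed

text \<open>
  Removing the factor $e^{-S}$ from the product of gamma densities leaves a measure that is homogeneous of degree
  $\beta$. Restricted to the scale invariant event $U \in B$, it gives the set $S \le r$ the mass $r^\beta m_B(1)$.
  Hence its image under $S$ has the density $m_B(1)\,\beta r^{\beta-1}$, in which $B$ enters only through a
  constant factor. Multiplying by $e^{-r}$ again yields both the independence and the gamma law of $S$.
\<close>

theorem gamma_sum_independent_of_shape:
  fixes I :: "'i set" and U :: "('i \<Rightarrow> real) \<Rightarrow> real"
  assumes "\<alpha> > 0" and I: "finite I" "I \<noteq> {}"
  defines "P \<equiv> PiM I (\<lambda>_. gamma_measure \<alpha>)" and "\<beta> \<equiv> \<alpha> * card I"
  assumes U[measurable]: "U \<in> borel_measurable (PiM I (\<lambda>_. borel))"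
    and inv: "\<And>r x. r > 0 \<Longrightarrow> U (\<lambda>i\<in>I. r * x i) = U x"
  shows "distr P (borel \<Otimes>\<^sub>M borel) (\<lambda>x. (\<Sum>i\<in>I. x i, U x)) = gamma_measure \<beta> \<Otimes>\<^sub>M distr P borel U"
proof -
  have \<beta>: "\<beta> > 0" using assms by (simp add: \<beta>_def card_gt_0_iff)
  interpret \<gamma>: prob_space "gamma_measure \<alpha>" by (rule prob_space_gamma_measure[OF assms(1)])
  interpret G: product_prob_space "\<lambda>_::'i. gamma_measure \<alpha>" I ..
  interpret P: prob_space P unfolding P_def by (rule prob_space_PiM) unfold_locales
  have [measurable_cong, simp]: "sets P = sets (PiM I (\<lambda>_. borel))" unfolding P_def by (intro sets_PiM_cong) auto
  define S where "S = (\<lambda>x::'i \<Rightarrow> real. \<Sum>i\<in>I. x i)"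
  have [measurable]: "S \<in> borel_measurable (PiM I (\<lambda>_. borel))" unfolding S_def by measurable
  have posP: "AE x in P. \<forall>i\<in>I. x i > 0"
    using I unfolding P_def by (intro AE_finite_allI AE_PiM_component AE_gamma_measure_pos \<gamma>.prob_space_axioms prob_space_gamma_measure assms)
  have S_scale: "S (\<lambda>i\<in>I. r * x i) = r * S x" for r x by (simp add: S_def sum_distrib_left)
  define m where "m = (\<lambda>B r. \<integral>\<^sup>+x. ennreal (exp (S x)) * indicator B (U x) * indicator {..r} (S x) \<partial>P)"
  have m_scale: "m B r = ennreal (r powr \<beta>) * m B 1" if [measurable]: "B \<in> sets borel" and r: "r > 0" for B r
  proof -
    \<comment> \<open>The weight is chosen such that the tilting factor turns it into the weight of \<open>m\<close>.\<close>
    define H where "H = (\<lambda>x. ennreal (exp (S x / r)) * indicator B (U x) * indicator {..r} (S x))"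
    have "m B 1 = (\<integral>\<^sup>+x. H (\<lambda>i\<in>I. r * x i) \<partial>P)"
      unfolding m_def H_def S_scale inv[OF r] using r by (intro nn_integral_cong) (simp add: indicator_def)
    also have "\<dots> = (\<integral>\<^sup>+x. ennreal (r powr (- \<beta>) * exp (S x - S x / r)) * H x \<partial>P)"
      unfolding P_def \<beta>_def S_def
      by (rule PiM_gamma_scale[OF assms(1) r I(1)]) (simp add: H_def)
    also have "\<dots> = (\<integral>\<^sup>+x. ennreal (r powr (- \<beta>)) * (ennreal (exp (S x)) * indicator B (U x) * indicator {..r} (S x)) \<partial>P)"
    proof (rule nn_integral_cong)
      fix x
      have "ennreal (exp (S x - S x / r)) * ennreal (exp (S x / r)) = ennreal (exp (S x))"
        by (subst ennreal_mult[symmetric]) (auto simp: exp_add[symmetric])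
      then show "ennreal (r powr (- \<beta>) * exp (S x - S x / r)) * H x
          = ennreal (r powr (- \<beta>)) * (ennreal (exp (S x)) * indicator B (U x) * indicator {..r} (S x))"
        unfolding H_def by (simp add: ennreal_mult mult.assoc[symmetric]) (simp add: mult.assoc)
    qed
    also have "\<dots> = ennreal (r powr (- \<beta>)) * m B r" unfolding m_def by (rule nn_integral_cmult) simp
    finally have "ennreal (r powr \<beta>) * m B 1 = ennreal (r powr \<beta>) * ennreal (r powr (- \<beta>)) * m B r"
      by (simp add: mult.assoc)
    also have "ennreal (r powr \<beta>) * ennreal (r powr (- \<beta>)) = 1"
      using r by (subst ennreal_mult[symmetric]) (auto simp: powr_minus)
    finally show ?thesis by simp
  qed
  have m0: "m B r = 0" if [measurable]: "B \<in> sets borel" and r: "r \<le> 0" for B r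
  proof -
    have "AE x in P. S x > 0"
      using posP by eventually_elim (use I in \<open>auto simp: S_def intro: sum_pos\<close>)
    then have "AE x in P. ennreal (exp (S x)) * indicator B (U x) * indicator {..r} (S x) = 0"
      by eventually_elim (use r in auto)
    then show ?thesis unfolding m_def by (subst nn_integral_0_iff_AE) auto
  qed
  have m1: "m B 1 < \<infinity>" for B
  proof -
    have "m B 1 \<le> (\<integral>\<^sup>+x. ennreal (exp 1) \<partial>P)"
      unfolding m_def by (intro nn_integral_mono) (auto simp: indicator_def intro: ennreal_leI)
    also have "\<dots> < \<infinity>" by (simp add: P.emeasure_space_1)
    finally show ?thesis .
  qed
  define q where "q = (\<lambda>r. ennreal (\<beta> * r powr (\<beta> - 1)) * indicator {0<..} r)"
  have [measurable]: "q \<in> borel_measurable borel" unfolding q_def by measurable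
  have q_mass: "(\<integral>\<^sup>+r. q r * indicator {..R} r \<partial>lborel) = (if R > 0 then ennreal (R powr \<beta>) else 0)" for R
  proof (cases "R > 0")
    case True
    have "((\<lambda>r. \<beta> * r powr (\<beta> - 1)) has_integral (\<beta> * (R powr \<beta> / \<beta>))) {0..R}"
      using has_integral_powr_from_0[of "\<beta> - 1" R] \<beta> True by (intro has_integral_mult_right) simp
    then have "(\<integral>\<^sup>+r. ennreal (indicator {0..R} r * (\<beta> * r powr (\<beta> - 1))) \<partial>lborel) = ennreal (R powr \<beta>)"
      using nn_integral_has_integral_lebesgue[of "{0..R}" "\<lambda>r. \<beta> * r powr (\<beta> - 1)"] \<beta> by simp
    also have "(\<integral>\<^sup>+r. ennreal (indicator {0..R} r * (\<beta> * r powr (\<beta> - 1))) \<partial>lborel) = (\<integral>\<^sup>+r. q r * indicator {..R} r \<partial>lborel)"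
      by (intro nn_integral_cong) (auto simp: q_def indicator_def)
    finally show ?thesis using True by simp
  next
    case False
    then have "(\<lambda>r. q r * indicator {..R} r) = (\<lambda>_. 0)" by (auto simp: q_def indicator_def)
    then show ?thesis using False by simp
  qed
  have law: "distr (density P (\<lambda>x. ennreal (exp (S x)) * indicator B (U x))) borel S = density lborel (\<lambda>r. m B 1 * q r)"
    (is "?L = ?R") if B[measurable]: "B \<in> sets borel" for B
  proof (rule measure_eqI_generator_eq)
    have L: "emeasure ?L {..R} = m B R" for R
    proof -
      have "emeasure ?L {..R} = emeasure (density P (\<lambda>x. ennreal (exp (S x)) * indicator B (U x))) {x \<in> space P. S x \<le> R}"
        by (subst emeasure_distr) (auto intro!: arg_cong2[where f=emeasure])
      also have "\<dots> = m B R"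
      proof -
        have M: "{x \<in> space P. S x \<le> R} \<in> sets P" by measurable
        show ?thesis
          unfolding m_def by (subst emeasure_density[OF _ M]) (auto simp: indicator_def intro!: nn_integral_cong)
      qed
      finally show ?thesis .
    qed
    have R: "emeasure ?R {..R} = m B R" for R
    proof -
      have "emeasure ?R {..R} = (\<integral>\<^sup>+r. m B 1 * (q r * indicator {..R} r) \<partial>lborel)"
        by (subst emeasure_density) (auto simp: mult.assoc)
      also have "\<dots> = m B 1 * (\<integral>\<^sup>+r. q r * indicator {..R} r \<partial>lborel)" by (rule nn_integral_cmult) simp
      also have "\<dots> = m B R" using m_scale[OF B, of R] m0[OF B, of R] by (auto simp: q_mass mult.commute)
      finally show ?thesis .
    qed
    show "emeasure ?L X = emeasure ?R X" if "X \<in> range (\<lambda>a::real. {..a})" for X using that L R by auto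
    show "Int_stable (range (\<lambda>a::real. {..a}))"
      by (auto simp: Int_stable_def)
    have "sets (borel :: real measure) = sigma_sets UNIV (range (\<lambda>a::real. {..a}))"
      by (subst borel_eq_atMost, rule sets_measure_of) auto
    then show "sets ?L = sigma_sets UNIV (range (\<lambda>a::real. {..a}))" "sets ?R = sigma_sets UNIV (range (\<lambda>a::real. {..a}))"
      by simp_all
    show "range (\<lambda>i::nat. {..real i}) \<subseteq> range (\<lambda>a::real. {..a})" by auto
    show "(\<Union>i::nat. {..real i}) = UNIV" by (auto intro: real_arch_simple)
    show "emeasure ?L {..real i} \<noteq> \<infinity>" for i
      unfolding L using m_scale[OF B, of "real i"] m0[OF B, of "real i"] m1[of B]
      by (cases "real i > 0") (auto simp: ennreal_mult_eq_top_iff)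
  qed simp
  have key: "emeasure P {x \<in> space P. S x \<in> A \<and> U x \<in> B} = m B 1 * ennreal (Gamma (\<beta> + 1)) * emeasure (gamma_measure \<beta>) A"
    if [measurable]: "A \<in> sets borel" and B[measurable]: "B \<in> sets borel" for A B
  proof -
    have "emeasure P {x \<in> space P. S x \<in> A \<and> U x \<in> B} = (\<integral>\<^sup>+x. indicator {x \<in> space P. S x \<in> A \<and> U x \<in> B} x \<partial>P)"
    proof -
      have "{x \<in> space P. S x \<in> A \<and> U x \<in> B} \<in> sets P" by measurable
      then show ?thesis by (simp only: nn_integral_indicator)
    qed
    also have "\<dots> = (\<integral>\<^sup>+x. (ennreal (exp (S x)) * indicator B (U x)) * (ennreal (exp (- S x)) * indicator A (S x)) \<partial>P)"
    proof (rule nn_integral_cong)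
      fix x assume "x \<in> space P"
      moreover have "ennreal (exp (S x)) * ennreal (exp (- S x)) = 1"
        by (subst ennreal_mult[symmetric]) (auto simp: exp_add[symmetric])
      ultimately show "indicator {x \<in> space P. S x \<in> A \<and> U x \<in> B} x
         = (ennreal (exp (S x)) * indicator B (U x)) * (ennreal (exp (- S x)) * indicator A (S x))"
        by (auto simp: indicator_def)
    qed
    also have "\<dots> = (\<integral>\<^sup>+x. ennreal (exp (- S x)) * indicator A (S x) \<partial>density P (\<lambda>x. ennreal (exp (S x)) * indicator B (U x)))"
      by (subst nn_integral_density) auto
    also have "\<dots> = (\<integral>\<^sup>+r. ennreal (exp (- r)) * indicator A r \<partial>distr (density P (\<lambda>x. ennreal (exp (S x)) * indicator B (U x))) borel S)"
      by (subst nn_integral_distr) auto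
    also have "\<dots> = (\<integral>\<^sup>+r. m B 1 * q r * (ennreal (exp (- r)) * indicator A r) \<partial>lborel)"
      unfolding law[OF B] by (subst nn_integral_density) auto
    also have "\<dots> = (\<integral>\<^sup>+r. m B 1 * ennreal (Gamma (\<beta> + 1)) * (ennreal (gamma_density \<beta> r) * indicator A r) \<partial>lborel)"
    proof (rule nn_integral_cong)
      fix r :: real
      have "q r * ennreal (exp (- r)) = ennreal (Gamma (\<beta> + 1)) * ennreal (gamma_density \<beta> r)"
        using Gamma_mass_unit[OF \<beta>, of r] by (simp add: q_def mult_ac)
      then show "m B 1 * q r * (ennreal (exp (- r)) * indicator A r) = m B 1 * ennreal (Gamma (\<beta> + 1)) * (ennreal (gamma_density \<beta> r) * indicator A r)"
        by (metis (no_types) mult.assoc)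
    qed
    also have "\<dots> = m B 1 * ennreal (Gamma (\<beta> + 1)) * emeasure (gamma_measure \<beta>) A"
      unfolding gamma_measure_def by (subst emeasure_density, simp, simp) (rule nn_integral_cmult, simp)
    finally show ?thesis .
  qed
  have Q: "prob_space (gamma_measure \<beta>)" by (rule prob_space_gamma_measure[OF \<beta>])
  then have Q1: "emeasure (gamma_measure \<beta>) UNIV = 1" using prob_space.emeasure_space_1 by force
  have DU: "prob_space (distr P borel U)" by (rule P.prob_space_distr) simp
  have "gamma_measure \<beta> \<Otimes>\<^sub>M distr P borel U = distr P (borel \<Otimes>\<^sub>M borel) (\<lambda>x. (S x, U x))"
  proof (rule pair_measure_eqI)
    show "sigma_finite_measure (gamma_measure \<beta>)" "sigma_finite_measure (distr P borel U)"
      using Q DU by (auto intro: prob_space_imp_sigma_finite)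
    show "sets (gamma_measure \<beta> \<Otimes>\<^sub>M distr P borel U) = sets (distr P (borel \<Otimes>\<^sub>M borel) (\<lambda>x. (S x, U x)))"
      by (simp cong: sets_pair_measure_cong)
    fix A B assume "A \<in> sets (gamma_measure \<beta>)" "B \<in> sets (distr P borel U)"
    then have [measurable]: "A \<in> sets borel" and B[measurable]: "B \<in> sets borel" by auto
    have "emeasure (distr P borel U) B = emeasure P {x \<in> space P. S x \<in> UNIV \<and> U x \<in> B}"
      by (subst emeasure_distr) (auto intro!: arg_cong2[where f=emeasure])
    also have "\<dots> = m B 1 * ennreal (Gamma (\<beta> + 1))" by (subst key) (auto simp: Q1)
    finally have "emeasure (gamma_measure \<beta>) A * emeasure (distr P borel U) B = emeasure P {x \<in> space P. S x \<in> A \<and> U x \<in> B}"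
      by (subst key) (auto simp: mult_ac)
    also have "\<dots> = emeasure (distr P (borel \<Otimes>\<^sub>M borel) (\<lambda>x. (S x, U x))) (A \<times> B)"
      by (subst emeasure_distr) (auto intro!: arg_cong2[where f=emeasure])
    finally show "emeasure (gamma_measure \<beta>) A * emeasure (distr P borel U) B = emeasure (distr P (borel \<Otimes>\<^sub>M borel) (\<lambda>x. (S x, U x))) (A \<times> B)" .
  qed
  then show ?thesis by (simp add: S_def)
qed

section \<open>Absence of atoms, and integrability of the powers of $\psi$\<close>

text \<open>
  With all coordinates but one fixed and positive, the equation for the remaining coordinate $y$ is
  $y^2 + q = c(y+\sigma)^2$, a nonzero polynomial equation: if $c = 1$ removes the quadratic term, the linear
  coefficient is $-2\sigma \neq 0$. So the exceptional set is finite in each fibre, hence null by Fubini.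
\<close>

lemma AE_shape_ne:
  fixes i :: 'i
  assumes "\<alpha> > 0" and J: "finite J" "J \<noteq> {}" "i \<notin> J"
  shows "AE x in PiM (insert i J) (\<lambda>_. gamma_measure \<alpha>).
     (\<Sum>j\<in>insert i J. (x j)\<^sup>2) / (\<Sum>j\<in>insert i J. x j)\<^sup>2 \<noteq> c"
proof -
  define P where "P = PiM (insert i J) (\<lambda>_. gamma_measure \<alpha>)"
  define U where "U = (\<lambda>x::'i \<Rightarrow> real. (\<Sum>j\<in>insert i J. (x j)\<^sup>2) / (\<Sum>j\<in>insert i J. x j)\<^sup>2)"
  interpret \<gamma>: prob_space "gamma_measure \<alpha>" by (rule prob_space_gamma_measure[OF assms(1)])
  interpret G: product_sigma_finite "\<lambda>_::'i. gamma_measure \<alpha>" ..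
  have [measurable_cong, simp]: "sets P = sets (PiM (insert i J) (\<lambda>_. borel))" unfolding P_def by (intro sets_PiM_cong) auto
  have [measurable]: "U \<in> borel_measurable (PiM (insert i J) (\<lambda>_. borel))" unfolding U_def by measurable
  have N: "{x \<in> space P. U x = c} \<in> sets P" by measurable
  have posP: "AE x in PiM J (\<lambda>_. gamma_measure \<alpha>). \<forall>j\<in>J. x j > 0"
    using J by (intro AE_finite_allI AE_PiM_component AE_gamma_measure_pos prob_space_gamma_measure assms)
  have null: "AE y in gamma_measure \<alpha>. y \<notin> F" if "finite F" for F :: "real set"
    unfolding gamma_measure_def
    by (subst AE_density) (use finite_imp_null_set_lborel[OF that, THEN AE_not_in] in auto)
  have "emeasure P {x \<in> space P. U x = c} = (\<integral>\<^sup>+x. indicator {x. U x = c} x \<partial>P)"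
    unfolding nn_integral_indicator[OF N, symmetric] by (intro nn_integral_cong) (auto simp: indicator_def)
  also have "\<dots> = (\<integral>\<^sup>+x. \<integral>\<^sup>+y. indicator {x. U x = c} (x(i := y)) \<partial>gamma_measure \<alpha> \<partial>PiM J (\<lambda>_. gamma_measure \<alpha>))"
  proof -
    have "indicator {x. U x = c} \<in> borel_measurable P"
      by (rule measurable_cong[THEN iffD1, OF _ borel_measurable_indicator[OF N]]) (auto simp: indicator_def)
    then show ?thesis unfolding P_def by (intro G.product_nn_integral_insert J)
  qed
  also have "\<dots> = (\<integral>\<^sup>+x. 0 \<partial>PiM J (\<lambda>_. gamma_measure \<alpha>))"
  proof (rule nn_integral_cong_AE, use posP in eventually_elim)
    fix x :: "'i \<Rightarrow> real" assume x: "\<forall>j\<in>J. x j > 0"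
    define \<sigma> q where "\<sigma> = (\<Sum>j\<in>J. x j)" and "q = (\<Sum>j\<in>J. (x j)\<^sup>2)"
    have \<sigma>: "\<sigma> > 0" unfolding \<sigma>_def using x J by (intro sum_pos) auto
    define p where "p = [:q - c * \<sigma>\<^sup>2, - 2 * c * \<sigma>, 1 - c:]"
    have "p \<noteq> 0" using \<sigma> by (auto simp: p_def)
    \<comment> \<open>The point \<open>- \<sigma>\<close>, where the quotient is a division by zero, is not covered by the polynomial.\<close>
    then have fin: "finite (insert (- \<sigma>) {y. poly p y = 0})" using poly_roots_finite by blast
    have U_upd: "U (x(i := y)) = (y\<^sup>2 + q) / (y + \<sigma>)\<^sup>2" for y
    proof -
      have "(x(i := y)) j = x j" if "j \<in> J" for j using that J by auto
      then have "(\<Sum>j\<in>J. ((x(i := y)) j)\<^sup>2) = q" "(\<Sum>j\<in>J. (x(i := y)) j) = \<sigma>"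
        unfolding q_def \<sigma>_def by (simp_all cong: sum.cong)
      then show ?thesis using J unfolding U_def by simp
    qed
    have sub: "{y. U (x(i := y)) = c} \<subseteq> insert (- \<sigma>) {y. poly p y = 0}"
    proof
      fix y assume "y \<in> {y. U (x(i := y)) = c}"
      then have *: "(y\<^sup>2 + q) / (y + \<sigma>)\<^sup>2 = c" by (simp add: U_upd)
      show "y \<in> insert (- \<sigma>) {y. poly p y = 0}"
      proof (cases "y + \<sigma> = 0")
        case False
        with * have "y\<^sup>2 + q = c * (y + \<sigma>)\<^sup>2" by (simp add: field_simps)
        then show ?thesis by (simp add: p_def power2_eq_square algebra_simps)
      qed simp
    qed
    have "(\<integral>\<^sup>+y. indicator {x. U x = c} (x(i := y)) \<partial>gamma_measure \<alpha>) = (\<integral>\<^sup>+y. 0 \<partial>gamma_measure \<alpha>)"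
    proof (rule nn_integral_cong_AE, use null[OF fin] in eventually_elim)
      fix y assume "y \<notin> insert (- \<sigma>) {y. poly p y = 0}"
      then show "indicator {x. U x = c} (x(i := y)) = (0 :: ennreal)" using sub by (auto simp: indicator_def)
    qed
    then show "(\<integral>\<^sup>+y. indicator {x. U x = c} (x(i := y)) \<partial>gamma_measure \<alpha>) = 0" by simp
  qed
  finally have "emeasure P {x \<in> space P. U x = c} = 0" by simp
  then have "AE x in P. U x \<noteq> c" by (subst AE_iff_measurable[OF N]) auto
  then show ?thesis unfolding P_def U_def .
qed

lemma integrable_norm_powr:
  assumes "c > 1"
  shows "integrable lborel (\<lambda>s. norm (1 - \<i> * complex_of_real s) powr (- c))"
proof -
  define h where "h = (\<lambda>s::real. indicator {0..} s * (1 + s) powr (- c))"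
  have "(\<integral>\<^sup>+s. ennreal ((1 + s) powr (- c)) * indicator {0..} s \<partial>lborel) = ennreal (0 - (- ((1 + 0) powr (1 - c) / (c - 1))))"
  proof (rule nn_integral_FTC_atLeast)
    fix s :: real assume s: "0 \<le> s"
    have "((\<lambda>s. - ((1 + s) powr (1 - c) / (c - 1))) has_real_derivative
        - ((1 - c) * (1 + s) powr (1 - c - of_nat 1) * 1 / (c - 1))) (at s)"
      using s by (intro DERIV_minus DERIV_cdivide DERIV_fun_powr) (auto intro!: derivative_eq_intros)
    also have "- ((1 - c) * (1 + s) powr (1 - c - of_nat 1) * 1 / (c - 1)) = (1 + s) powr (- c)"
      using assms by (simp add: divide_simps) (simp add: algebra_simps)
    finally show "((\<lambda>s. - ((1 + s) powr (1 - c) / (c - 1))) has_real_derivative (1 + s) powr (- c)) (at s)" .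
  next
    show "((\<lambda>s. - ((1 + s) powr (1 - c) / (c - 1))) \<longlongrightarrow> 0) at_top" using assms by real_asymp
  qed auto
  then have "(\<integral>\<^sup>+s. ennreal (h s) \<partial>lborel) = ennreal (1 / (c - 1))"
    by (simp add: h_def ennreal_mult' ennreal_indicator mult.commute)
  then have "has_bochner_integral lborel h (1 / (c - 1))"
    using assms by (intro has_bochner_integral_nn_integral) (auto simp: h_def)
  then have h: "integrable lborel h" by (simp add: has_bochner_integral_iff)
  have h': "integrable lborel (\<lambda>s. h (0 + (-1) * s))" using h by (rule lborel_integrable_real_affine) simp
  have "integrable lborel (\<lambda>s. 2 powr c * (h s + h (0 + (-1) * s)))"
    using h h' by (intro integrable_mult_right Bochner_Integration.integrable_add)
  then show ?thesis
  proof (rule Bochner_Integration.integrable_bound)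
    show "AE s in lborel. norm (norm (1 - \<i> * complex_of_real s) powr (- c)) \<le> norm (2 powr c * (h s + h (0 + (-1) * s)))"
    proof (intro AE_I2)
      fix s :: real
      have "\<bar>s\<bar> \<le> norm (1 - \<i> * complex_of_real s)" "1 \<le> norm (1 - \<i> * complex_of_real s)"
        using abs_Im_le_cmod[of "1 - \<i> * complex_of_real s"] abs_Re_le_cmod[of "1 - \<i> * complex_of_real s"] by auto
      then have "norm (1 - \<i> * complex_of_real s) powr (- c) \<le> ((1 + \<bar>s\<bar>) / 2) powr (- c)"
        using assms by (intro powr_mono2') auto
      also have "\<dots> = 2 powr c * (1 + \<bar>s\<bar>) powr (- c)" by (simp add: powr_divide powr_minus field_simps)
      also have "\<dots> \<le> 2 powr c * (h s + h (0 + (-1) * s))" by (intro mult_left_mono) (auto simp: h_def indicator_def)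
      also have "\<dots> \<le> norm (2 powr c * (h s + h (0 + (-1) * s)))" by simp
      finally show "norm (norm (1 - \<i> * complex_of_real s) powr (- c)) \<le> norm (2 powr c * (h s + h (0 + (-1) * s)))"
        by simp
    qed
  qed simp
qed

lemma psi_eq_expectation:
  assumes "\<alpha> > 0" "t > 0"
  shows "psi \<alpha> s t = (\<integral>y. iexp (s * y + t * y\<^sup>2) \<partial>gamma_measure \<alpha>)"
proof -
  have "(\<integral>y. iexp (s * y + t * y\<^sup>2) \<partial>gamma_measure \<alpha>) = (LBINT y. gamma_density \<alpha> y *\<^sub>R iexp (s * y + t * y\<^sup>2))"
    unfolding gamma_measure_def using gamma_density_nonneg[OF assms(1)] by (subst integral_density) auto
  also have "\<dots> = (LBINT y. complex_of_real (1 / Gamma \<alpha>) * (indicator {0<..} y *\<^sub>R (complex_of_real (y powr (\<alpha> - 1)) * exp (\<i> * complex_of_real t * (complex_of_real y)\<^sup>2 - (1 - \<i> * complex_of_real s) * complex_of_real y))))"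
  proof (rule Bochner_Integration.integral_cong[OF refl])
    fix y :: real
    have "exp (\<i> * complex_of_real t * (complex_of_real y)\<^sup>2 - (1 - \<i> * complex_of_real s) * complex_of_real y) = complex_of_real (exp (- y)) * iexp (s * y + t * y\<^sup>2)"
      unfolding exp_of_real[symmetric] exp_add[symmetric] by (simp add: algebra_simps)
    then show "gamma_density \<alpha> y *\<^sub>R iexp (s * y + t * y\<^sup>2)
        = complex_of_real (1 / Gamma \<alpha>) * (indicator {0<..} y *\<^sub>R (complex_of_real (y powr (\<alpha> - 1)) * exp (\<i> * complex_of_real t * (complex_of_real y)\<^sup>2 - (1 - \<i> * complex_of_real s) * complex_of_real y)))"
      by (simp add: gamma_density_def scaleR_conv_of_real field_simps)
  qed
  also have "\<dots> = complex_of_real (1 / Gamma \<alpha>) * (LBINT y:{0<..}. complex_of_real (y powr (\<alpha> - 1)) * exp (\<i> * complex_of_real t * (complex_of_real y)\<^sup>2 - (1 - \<i> * complex_of_real s) * complex_of_real y))"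
    unfolding set_lebesgue_integral_def by (rule integral_mult_right_zero)
  finally show ?thesis by (simp add: psi_eq[OF assms])
qed

lemma psi_measurable [measurable]:
  assumes "\<alpha> > 0" "t > 0"
  shows "(\<lambda>s. psi \<alpha> s t) \<in> borel_measurable borel"
proof -
  interpret \<gamma>: prob_space "gamma_measure \<alpha>" by (rule prob_space_gamma_measure[OF assms(1)])
  show ?thesis unfolding psi_eq_expectation[OF assms] by measurable
qed

text \<open>
  By the decay estimate, $\psi(s,t)^n = O(|1-is|^{-\min(\alpha,1)\,n})$; the exponent exceeds $1$ exactly if both
  $\alpha n$ and $n$ do.
\<close>

lemma psi_power_integrable:
  assumes "\<alpha> > 0" "t > 0" "\<alpha> * real n > 1" "n > 1"
  shows "integrable lborel (\<lambda>s. psi \<alpha> s t ^ n)"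
proof -
  obtain C where C: "\<And>s::real. norm (psi \<alpha> s t) \<le> C * norm (1 - \<i> * s) powr (- min \<alpha> 1)"
    using psi_decay[OF assms(1,2)] by blast
  have c: "min \<alpha> 1 * real n > 1" using assms by (auto simp: min_def)
  show ?thesis
  proof (rule Bochner_Integration.integrable_bound)
    show "integrable lborel (\<lambda>s. C ^ n * norm (1 - \<i> * complex_of_real s) powr (- (min \<alpha> 1 * real n)))"
      by (intro integrable_mult_right integrable_norm_powr c)
    show "(\<lambda>s. psi \<alpha> s t ^ n) \<in> borel_measurable lborel" using psi_measurable[OF assms(1,2)] by measurable
    show "AE s in lborel. norm (psi \<alpha> s t ^ n) \<le> norm (C ^ n * norm (1 - \<i> * complex_of_real s) powr (- (min \<alpha> 1 * real n)))"
    proof (intro AE_I2)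
      fix s :: real
      have nz: "norm (1 - \<i> * complex_of_real s) > 0"
        using abs_Re_le_cmod[of "1 - \<i> * complex_of_real s"] by simp
      have "norm (psi \<alpha> s t ^ n) \<le> (C * norm (1 - \<i> * s) powr (- min \<alpha> 1)) ^ n"
        unfolding norm_power by (intro power_mono C) simp
      also have "\<dots> = C ^ n * norm (1 - \<i> * complex_of_real s) powr (- (min \<alpha> 1 * real n))"
        using nz by (simp add: power_mult_distrib powr_power mult.commute)
      finally show "norm (psi \<alpha> s t ^ n) \<le> norm (C ^ n * norm (1 - \<i> * complex_of_real s) powr (- (min \<alpha> 1 * real n)))"
        by simp
    qed
  qed
qed

lemma gamma_density_bounded:
  assumes "\<beta> > 1"
  shows "gamma_density \<beta> r \<le> inverse (Gamma \<beta>) * (\<beta> - 1) powr (\<beta> - 1)"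
proof (cases "r > 0")
  case True
  define b where "b = \<beta> - 1"
  have b: "b > 0" using assms by (simp add: b_def)
  have "r / b \<le> exp (r / b)" using exp_ge_add_one_self[of "r / b"] by linarith
  then have "(r / b) powr b \<le> exp (r / b) powr b" using True b by (intro powr_mono2) auto
  also have "\<dots> = exp r" using b by (simp add: powr_def)
  finally have "r powr b \<le> b powr b * exp r" using True b by (simp add: powr_divide field_simps)
  then have "exp (- r) * r powr b \<le> b powr b" by (simp add: exp_minus field_simps)
  then show ?thesis using True assms Gamma_real_pos[of \<beta>]
    by (simp add: gamma_density_def b_def mult.assoc)
qed (use assms Gamma_real_pos[of \<beta>] in \<open>simp add: gamma_density_def\<close>)

lemma isCont_gamma_density:
  assumes "r > 0" shows "isCont (gamma_density \<beta>) r"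
proof -
  have "isCont (\<lambda>x. inverse (Gamma \<beta>) * exp (- x) * x powr (\<beta> - 1)) r"
    using assms by (intro continuous_intros) auto
  moreover have "eventually (\<lambda>x. gamma_density \<beta> x = inverse (Gamma \<beta>) * exp (- x) * x powr (\<beta> - 1)) (nhds r)"
    using eventually_nhds_in_open[of "{0<..}" r] assms
    by (auto elim!: eventually_mono simp: gamma_density_def)
  ultimately show ?thesis by (simp add: isCont_cong)
qed

section \<open>Inversion of the powers of $\psi$\<close>

lemma psi_power_eq_expectation:
  fixes I :: "'i set"
  assumes "\<alpha> > 0" "t > 0" "finite I"
  shows "psi \<alpha> s t ^ card I
    = (\<integral>x. iexp (s * (\<Sum>i\<in>I. x i) + t * (\<Sum>i\<in>I. (x i)\<^sup>2)) \<partial>PiM I (\<lambda>_. gamma_measure \<alpha>))"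
proof -
  interpret \<gamma>: prob_space "gamma_measure \<alpha>" by (rule prob_space_gamma_measure[OF assms(1)])
  interpret G: product_sigma_finite "\<lambda>_::'i. gamma_measure \<alpha>" ..
  have "iexp (s * (\<Sum>i\<in>I. x i) + t * (\<Sum>i\<in>I. (x i)\<^sup>2)) = (\<Prod>i\<in>I. iexp (s * x i + t * (x i)\<^sup>2))" for x :: "'i \<Rightarrow> real"
    using assms(3) by (simp add: exp_sum[symmetric] sum_distrib_left sum.distrib[symmetric])
  then have "(\<integral>x. iexp (s * (\<Sum>i\<in>I. x i) + t * (\<Sum>i\<in>I. (x i)\<^sup>2)) \<partial>PiM I (\<lambda>_. gamma_measure \<alpha>))
      = (\<integral>x. (\<Prod>i\<in>I. iexp (s * x i + t * (x i)\<^sup>2)) \<partial>PiM I (\<lambda>_. gamma_measure \<alpha>))" by simp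
  also have "\<dots> = (\<Prod>i\<in>I. \<integral>y. iexp (s * y + t * y\<^sup>2) \<partial>gamma_measure \<alpha>)"
    by (intro G.product_integral_prod assms \<gamma>.integrable_const_bound[of _ 1]) auto
  finally show ?thesis by (simp add: psi_eq_expectation[OF assms(1,2)])
qed

text \<open>
  The power of $\psi$ is the Fourier transform in $r$ of $g(r) = \gamma_\beta(r) h(r)$ with
  $h(r) = E \exp(itr^2U)$, by the independence of sum and shape. Evaluating the inverse transform at
  $r = \beta$ amounts to conditioning on the value $\beta$ of the sum. The condition $\beta > 1$ makes $\gamma_\beta$ bounded.
\<close>

theorem psi_power_inversion:
  fixes I :: "'i set" and \<alpha> t :: real
  assumes "\<alpha> > 0" "t > 0" and I: "finite I" "card I > 1"
  defines "P \<equiv> PiM I (\<lambda>_. gamma_measure \<alpha>)" and "\<beta> \<equiv> \<alpha> * card I"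
    and "U \<equiv> \<lambda>x::'i \<Rightarrow> real. (\<Sum>i\<in>I. (x i)\<^sup>2) / (\<Sum>i\<in>I. x i)\<^sup>2"
  assumes \<beta>1: "\<beta> > 1"
  shows "(LBINT s. psi \<alpha> s t ^ card I * iexp (- (s * \<beta>)))
    = complex_of_real (2 * pi * gamma_density \<beta> \<beta>) * (\<integral>x. iexp (t * \<beta>\<^sup>2 * U x) \<partial>P)"
proof -
  have \<beta>: "\<beta> > 0" using \<beta>1 by simp
  have I0: "I \<noteq> {}" using I by auto
  interpret \<gamma>: prob_space "gamma_measure \<alpha>" by (rule prob_space_gamma_measure[OF assms(1)])
  interpret P: prob_space P unfolding P_def by (rule prob_space_PiM) unfold_locales
  interpret Q: prob_space "gamma_measure \<beta>" by (rule prob_space_gamma_measure[OF \<beta>])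
  have [measurable_cong, simp]: "sets P = sets (PiM I (\<lambda>_. borel))" unfolding P_def by (intro sets_PiM_cong) auto
  have [measurable]: "U \<in> borel_measurable (PiM I (\<lambda>_. borel))" unfolding U_def by measurable
  define D where "D = distr P borel U"
  interpret D: prob_space D unfolding D_def by (rule P.prob_space_distr) simp
  interpret QD: pair_prob_space "gamma_measure \<beta>" D ..
  have [measurable_cong, simp]: "sets D = sets borel" by (simp add: D_def)
  define S where "S = (\<lambda>x::'i \<Rightarrow> real. \<Sum>i\<in>I. x i)"
  have [measurable]: "S \<in> borel_measurable (PiM I (\<lambda>_. borel))" unfolding S_def by measurable
  have U_inv: "U (\<lambda>i\<in>I. r * x i) = U x" if "r > 0" for r x
  proof -
    have "U (\<lambda>i\<in>I. r * x i) = (r\<^sup>2 * (\<Sum>i\<in>I. (x i)\<^sup>2)) / (r\<^sup>2 * (\<Sum>i\<in>I. x i)\<^sup>2)"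
      by (simp add: U_def power_mult_distrib sum_distrib_left[symmetric])
    then show ?thesis using that by (simp add: U_def)
  qed
  have law: "distr P (borel \<Otimes>\<^sub>M borel) (\<lambda>x. (S x, U x)) = gamma_measure \<beta> \<Otimes>\<^sub>M D"
    unfolding P_def S_def D_def \<beta>_def
    by (rule gamma_sum_independent_of_shape) (use assms I0 U_inv in auto)
  have posP: "AE x in P. \<forall>i\<in>I. x i > 0"
    using I unfolding P_def by (intro AE_finite_allI AE_PiM_component AE_gamma_measure_pos prob_space_gamma_measure assms)
  have U01: "AE u in D. \<bar>u\<bar> \<le> 1"
    unfolding D_def
  proof (subst AE_distr_iff)
    show "AE x in P. \<bar>U x\<bar> \<le> 1"
      using posP
    proof eventually_elim
      case (elim x)
      then have S: "S x > 0" unfolding S_def using I I0 by (intro sum_pos) auto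
      have "(\<Sum>i\<in>I. (x i)\<^sup>2) \<le> (\<Sum>i\<in>I. x i * S x)"
      proof (rule sum_mono)
        fix i assume i: "i \<in> I"
        have "x i \<le> S x" unfolding S_def using elim i I by (intro member_le_sum) (auto simp: less_imp_le)
        then show "(x i)\<^sup>2 \<le> x i * S x" using elim i by (auto simp: power2_eq_square intro!: mult_left_mono less_imp_le)
      qed
      also have "\<dots> = (S x)\<^sup>2" by (simp add: S_def power2_eq_square sum_distrib_right)
      finally have "(\<Sum>i\<in>I. (x i)\<^sup>2) / (S x)\<^sup>2 \<le> 1" using S by simp
      moreover have "U x = (\<Sum>i\<in>I. (x i)\<^sup>2) / (S x)\<^sup>2" by (simp add: U_def S_def)
      moreover have "(\<Sum>i\<in>I. (x i)\<^sup>2) / (S x)\<^sup>2 \<ge> 0" by (intro divide_nonneg_nonneg sum_nonneg) auto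
      ultimately show ?case by simp
    qed
  qed auto
  define h where "h = (\<lambda>r. \<integral>u. iexp (t * r\<^sup>2 * u) \<partial>D)"
  have h_norm: "norm (h r) \<le> 1" for r
    unfolding h_def by (rule order_trans[OF integral_norm_bound]) (simp add: D.prob_space)
  have [measurable]: "h \<in> borel_measurable borel" unfolding h_def by measurable
  have h_cont: "isCont h r" for r
    unfolding continuous_at_sequentially comp_def
  proof safe
    fix u :: "nat \<Rightarrow> real" assume u: "u \<longlonglongrightarrow> r"
    show "(\<lambda>m. h (u m)) \<longlonglongrightarrow> h r"
      unfolding h_def
      by (rule integral_dominated_convergence[where w = "\<lambda>_. 1"]) (auto intro!: tendsto_intros u)
  qed
  define g where "g = (\<lambda>r. complex_of_real (gamma_density \<beta> r) * h r)"
  have [measurable]: "g \<in> borel_measurable borel" unfolding g_def by measurable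
  have gd_int: "integrable lborel (gamma_density \<beta>)"
  proof (rule integrableI_nonneg)
    have "(\<integral>\<^sup>+y. ennreal (gamma_density \<beta> y) \<partial>lborel) = 1"
      using Q.emeasure_space_1 by (simp add: gamma_measure_def emeasure_density)
    then show "(\<integral>\<^sup>+y. ennreal (gamma_density \<beta> y) \<partial>lborel) < \<infinity>" by simp
  qed (use gamma_density_nonneg[OF \<beta>] in auto)
  have g_int: "integrable lborel g"
    by (rule Bochner_Integration.integrable_bound[OF gd_int])
       (use gamma_density_nonneg[OF \<beta>] h_norm in \<open>auto simp: g_def norm_mult intro: mult_left_le\<close>)
  have char: "psi \<alpha> s t ^ card I = (LBINT r. iexp (s * r) * g r)" for s
  proof -
    have "psi \<alpha> s t ^ card I = (\<integral>x. iexp (s * (\<Sum>i\<in>I. x i) + t * (\<Sum>i\<in>I. (x i)\<^sup>2)) \<partial>P)"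
      unfolding P_def by (rule psi_power_eq_expectation[OF assms(1,2) I(1)])
    also have "\<dots> = (\<integral>x. iexp (s * S x + t * (S x)\<^sup>2 * U x) \<partial>P)"
    proof (rule integral_cong_AE)
      show "AE x in P. iexp (s * (\<Sum>i\<in>I. x i) + t * (\<Sum>i\<in>I. (x i)\<^sup>2)) = iexp (s * S x + t * (S x)\<^sup>2 * U x)"
        using posP
      proof eventually_elim
        case (elim x)
        then have S: "S x > 0" unfolding S_def using I I0 by (intro sum_pos) auto
        then have "(\<Sum>i\<in>I. (x i)\<^sup>2) = (S x)\<^sup>2 * U x" by (simp add: U_def S_def)
        then show ?case by (simp add: S_def mult.assoc)
      qed
    qed auto
    also have "\<dots> = (\<integral>z. iexp (s * fst z + t * (fst z)\<^sup>2 * snd z) \<partial>distr P (borel \<Otimes>\<^sub>M borel) (\<lambda>x. (S x, U x)))"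
      by (subst integral_distr) auto
    also have "\<dots> = (\<integral>z. iexp (s * fst z + t * (fst z)\<^sup>2 * snd z) \<partial>(gamma_measure \<beta> \<Otimes>\<^sub>M D))"
      by (simp only: law)
    also have "\<dots> = (\<integral>r. \<integral>u. iexp (s * r + t * r\<^sup>2 * u) \<partial>D \<partial>gamma_measure \<beta>)"
      by (subst QD.integral_fst'[symmetric]) (auto intro!: QD.P.integrable_const_bound[of _ 1])
    also have "\<dots> = (\<integral>r. iexp (s * r) * h r \<partial>gamma_measure \<beta>)"
      unfolding h_def integral_mult_right_zero[symmetric]
      by (simp add: exp_add distrib_left)
    also have "\<dots> = (LBINT r. gamma_density \<beta> r *\<^sub>R (iexp (s * r) * h r))"
      unfolding gamma_measure_def using gamma_density_nonneg[OF \<beta>] by (subst integral_density) auto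
    also have "\<dots> = (LBINT r. iexp (s * r) * g r)"
      by (simp add: g_def scaleR_conv_of_real mult_ac)
    finally show ?thesis .
  qed
  have "(LBINT s. psi \<alpha> s t ^ card I * iexp (- (s * \<beta>))) = (LBINT s. (LBINT r. iexp (s * r) * g r) * iexp (- (s * \<beta>)))"
    by (simp only: char)
  also have "\<dots> = complex_of_real (2 * pi) * g \<beta>"
  proof (rule Fourier_inversion[OF g_int])
    show "norm (g r) \<le> inverse (Gamma \<beta>) * (\<beta> - 1) powr (\<beta> - 1)" for r
    proof -
      have "norm (g r) \<le> gamma_density \<beta> r * 1"
        unfolding g_def norm_mult using gamma_density_nonneg[OF \<beta>] h_norm by (intro mult_mono) auto
      then show ?thesis using gamma_density_bounded[OF \<beta>1, of r] by simp
    qed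
    show "isCont g \<beta>" unfolding g_def
      by (intro continuous_intros isCont_o2[OF isCont_gamma_density[OF \<beta>]] h_cont)
    show "integrable lborel (\<lambda>s. LBINT r. iexp (s * r) * g r)"
      unfolding char[symmetric]
      using assms(1,2) \<beta>1 I by (intro psi_power_integrable) (auto simp: \<beta>_def)
  qed
  also have "h \<beta> = (\<integral>x. iexp (t * \<beta>\<^sup>2 * U x) \<partial>P)"
    unfolding h_def D_def by (subst integral_distr) auto
  then have "complex_of_real (2 * pi) * g \<beta> = complex_of_real (2 * pi * gamma_density \<beta> \<beta>) * (\<integral>x. iexp (t * \<beta>\<^sup>2 * U x) \<partial>P)"
    by (simp add: g_def)
  finally show ?thesis .
qed

section \<open>The distribution of the shape statistic\<close>

lemma U_sq_bounds:
  assumes "\<And>i. i \<in> {1..n} \<Longrightarrow> x i > 0" "n \<ge> 1"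
  shows "1 / real n \<le> U_sq (\<lambda>i x. x i) n x" "U_sq (\<lambda>i x. x i) n x \<le> 1"
proof -
  define S where "S = (\<Sum>i=1..n. x i)"
  have S: "S > 0" unfolding S_def using assms by (intro sum_pos) auto
  have U: "U_sq (\<lambda>i x. x i) n x = (\<Sum>i=1..n. (x i)\<^sup>2) / S\<^sup>2" by (simp add: U_sq_def S_def)
  have "S\<^sup>2 \<le> (\<Sum>i=1..n. (x i)\<^sup>2) * real n"
    unfolding S_def using sum_squared_le_sum_of_squares[of x "{1..n}"] assms by simp
  then show "1 / real n \<le> U_sq (\<lambda>i x. x i) n x"
    unfolding U using S assms by (simp add: field_simps)
  have "(\<Sum>i=1..n. (x i)\<^sup>2) \<le> (\<Sum>i=1..n. x i * S)"
  proof (rule sum_mono)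
    fix i assume i: "i \<in> {1..n}"
    have "x i \<le> S" unfolding S_def using assms i by (intro member_le_sum) (auto simp: less_imp_le)
    then show "(x i)\<^sup>2 \<le> x i * S" using assms(1)[OF i] by (auto simp: power2_eq_square intro!: mult_left_mono)
  qed
  also have "\<dots> = S\<^sup>2" by (simp add: S_def power2_eq_square sum_distrib_right)
  finally show "U_sq (\<lambda>i x. x i) n x \<le> 1" unfolding U using S by simp
qed

text \<open>
  The prefactor of the theorem is the reciprocal of $\pi^2\gamma_\beta(\beta)$ for the gamma density $\gamma_\beta$.
\<close>

lemma prefactor_times_density:
  assumes "\<beta> > 0"
  shows "Gamma (\<beta> + 1) / (pi\<^sup>2 * (\<beta> / exp 1) powr \<beta>) * (2 * pi * gamma_density \<beta> \<beta>) = 2 / pi"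
proof -
  have "\<beta> \<notin> \<int>\<^sub>\<le>\<^sub>0" using assms by (auto elim!: nonpos_Ints_cases)
  then have G: "Gamma (\<beta> + 1) = \<beta> * Gamma \<beta>" by (rule Gamma_plus1)
  have p: "(\<beta> / exp 1) powr \<beta> = \<beta> * \<beta> powr (\<beta> - 1) * exp (- \<beta>)"
    using assms by (simp add: powr_divide powr_diff exp_minus field_simps) (simp add: powr_def)
  have "\<beta> powr (\<beta> - 1) > 0" "Gamma \<beta> \<noteq> 0"
    using assms Gamma_real_pos[OF assms] by (simp, metis less_irrefl)
  then show ?thesis
    unfolding G p using assms by (simp add: gamma_density_def field_simps power2_eq_square)
qed

text \<open>
  The choice of the nodes gives $t_k\beta^2 = k\pi n/(n-1)$, so the phase $t_k\beta^2U - k\pi/(n-1)$ produced by the inversion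
  equals $k\pi(U-1/n)/(1-1/n)$, and its sine is the imaginary part of the inverted transform.
\<close>

lemma summand_integral:
  fixes n :: nat and \<alpha> :: real
  assumes "\<alpha> > 0" "real n > 1 + 1 / \<alpha>" "n > 1" "k \<ge> 1"
  defines "P \<equiv> PiM {1..n} (\<lambda>_. gamma_measure \<alpha>)" and "\<beta> \<equiv> \<alpha> * real n"
  defines "f \<equiv> \<lambda>s. Im (psi \<alpha> s (t_node \<alpha> n k) ^ n *
            exp (- \<i> * complex_of_real (\<alpha> * real n * s)
                 - \<i> * complex_of_real (inverse (real n - 1) * real k * pi)))"
  shows "integrable lborel f"
    and "integral\<^sup>L lborel f = 2 * pi * gamma_density \<beta> \<beta> *
       (\<integral>x. sin (real k * pi * ((U_sq (\<lambda>i x. x i) n x - 1 / real n) / (1 - 1 / real n))) \<partial>P)"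
proof -
  have \<beta>1: "\<beta> > 1"
  proof -
    have "\<alpha> * (1 + 1 / \<alpha>) < \<alpha> * real n" using assms by (intro mult_strict_left_mono) auto
    then show ?thesis using assms by (simp add: \<beta>_def distrib_left)
  qed
  define t where "t = t_node \<alpha> n k"
  have n1: "real n - 1 > 0" using assms by simp
  have t: "t > 0" unfolding t_def t_node_def using assms by (intro divide_pos_pos mult_pos_pos) auto
  have t\<beta>: "t * \<beta>\<^sup>2 = real k * pi * (real n / (real n - 1))"
    unfolding t_def t_node_def \<beta>_def using assms n1 by (simp add: power2_eq_square field_simps)
  \<comment> \<open>The phase factor that moves the lower end \<open>1 / n\<close> of the range of \<open>U\<close> to the origin.\<close>
  define c where "c = iexp (- (real k * pi / (real n - 1)))"
  define F where "F = (\<lambda>s. c * (psi \<alpha> s t ^ n * iexp (- (s * \<beta>))))"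
  interpret P: prob_space P unfolding P_def by (rule prob_space_PiM prob_space_gamma_measure assms)+
  have [measurable_cong, simp]: "sets P = sets (PiM {1..n} (\<lambda>_. borel))" unfolding P_def by (intro sets_PiM_cong) auto
  define U where "U = U_sq (\<lambda>i x::nat \<Rightarrow> real. x i) n"
  have [measurable]: "U \<in> borel_measurable (PiM {1..n} (\<lambda>_. borel))" unfolding U_def U_sq_def by measurable
  have f: "f = (\<lambda>s. Im (F s))"
  proof
    fix s
    have "exp (- \<i> * complex_of_real (\<alpha> * real n * s) - \<i> * complex_of_real (inverse (real n - 1) * real k * pi))
        = c * iexp (- (s * \<beta>))"
      unfolding c_def exp_add[symmetric] by (rule arg_cong[where f = exp]) (simp add: \<beta>_def divide_inverse algebra_simps)
    then show "f s = Im (F s)" by (simp only: f_def F_def t_def[symmetric] mult_ac)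
  qed
  have pw: "integrable lborel (\<lambda>s. psi \<alpha> s t ^ n)"
    using assms(1,3) t \<beta>1 by (intro psi_power_integrable) (auto simp: \<beta>_def)
  have "integrable lborel (\<lambda>s. psi \<alpha> s t ^ n * iexp (- (s * \<beta>)))"
    using pw borel_measurable_integrable[OF pw]
    by (intro Bochner_Integration.integrable_bound[OF pw]) (auto simp: norm_mult)
  then have F: "integrable lborel F" unfolding F_def by (rule integrable_mult_right)
  show "integrable lborel f" unfolding f using F by (rule integrable_Im)
  have inv: "(LBINT s. psi \<alpha> s t ^ n * iexp (- (s * \<beta>)))
      = complex_of_real (2 * pi * gamma_density \<beta> \<beta>) * (\<integral>x. iexp (t * \<beta>\<^sup>2 * U x) \<partial>P)"
    using psi_power_inversion[of \<alpha> t "{1..n}"] assms(1,3) t \<beta>1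
    by (simp add: \<beta>_def P_def U_def U_sq_def[abs_def])
  have "integral\<^sup>L lborel f = Im (integral\<^sup>L lborel F)" unfolding f using F by (rule integral_Im)
  also have "integral\<^sup>L lborel F = complex_of_real (2 * pi * gamma_density \<beta> \<beta>) * (\<integral>x. c * iexp (t * \<beta>\<^sup>2 * U x) \<partial>P)"
    unfolding F_def integral_mult_right_zero inv by (simp only: mult_ac)
  also have "Im \<dots> = 2 * pi * gamma_density \<beta> \<beta> * Im (\<integral>x. c * iexp (t * \<beta>\<^sup>2 * U x) \<partial>P)"
    by (simp only: Im_complex_of_real Re_complex_of_real times_complex.sel)
  also have "Im (\<integral>x. c * iexp (t * \<beta>\<^sup>2 * U x) \<partial>P) = (\<integral>x. Im (c * iexp (t * \<beta>\<^sup>2 * U x)) \<partial>P)"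
    by (intro integral_Im[symmetric] P.integrable_const_bound[of _ 1]) (auto simp: norm_mult c_def)
  also have "\<dots> = (\<integral>x. sin (real k * pi * ((U x - 1 / real n) / (1 - 1 / real n))) \<partial>P)"
  proof (rule Bochner_Integration.integral_cong[OF refl])
    fix x
    have "U x - 1 / real n = (real n * U x - 1) / real n" "1 - 1 / real n = (real n - 1) / real n"
      using n1 by (simp_all add: diff_divide_distrib)
    then have "(U x - 1 / real n) / (1 - 1 / real n) = (real n * U x - 1) / (real n - 1)"
      using n1 by simp
    then have "real k * pi * ((U x - 1 / real n) / (1 - 1 / real n)) = - (real k * pi / (real n - 1)) + t * \<beta>\<^sup>2 * U x"
      unfolding t\<beta> by (simp add: diff_divide_distrib right_diff_distrib mult_ac)
    moreover have "c * iexp (t * \<beta>\<^sup>2 * U x) = cis (- (real k * pi / (real n - 1)) + t * \<beta>\<^sup>2 * U x)"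
      by (simp only: c_def cis_conv_exp[symmetric] cis_mult)
    ultimately show "Im (c * iexp (t * \<beta>\<^sup>2 * U x)) = sin (real k * pi * ((U x - 1 / real n) / (1 - 1 / real n)))"
      by (simp only: cis.sel)
  qed
  finally show "integral\<^sup>L lborel f = 2 * pi * gamma_density \<beta> \<beta> *
       (\<integral>x. sin (real k * pi * ((U_sq (\<lambda>i x. x i) n x - 1 / real n) / (1 - 1 / real n))) \<partial>P)"
    by (simp add: U_def)
qed

theorem theorem3:
  fixes M :: "'a measure" and X :: "nat \<Rightarrow> 'a \<Rightarrow> real"
    and \<alpha> x :: real and n :: nat
  assumes "prob_space M"
    and "\<alpha> > 0"
    and "real n > max 3 (1 + 1 / \<alpha>)"
    and "prob_space.indep_vars M (\<lambda>_. borel) X {1..n}"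
    and "\<And>i. i \<in> {1..n} \<Longrightarrow> distributed M lborel (X i) (\<lambda>y. ennreal (gamma_density \<alpha> y))"
    and "0 \<le> x" and "x \<le> 1 - 1 / real n"
  shows "(\<forall>K. integrable lborel (partial_integrand \<alpha> n x K)) \<and>
    convergent (\<lambda>K. LBINT s. partial_integrand \<alpha> n x K s) \<and>
    measure M {\<omega> \<in> space M. U_sq X n \<omega> - 1 / real n \<le> x} =
      Gamma (\<alpha> * real n + 1) / (pi\<^sup>2 * (\<alpha> * real n / exp 1) powr (\<alpha> * real n)) *
      lim (\<lambda>K. LBINT s. partial_integrand \<alpha> n x K s)"
proof -
  interpret M: prob_space M by fact
  have n: "n > 1" "real n > 1 + 1 / \<alpha>" using assms(3) by auto
  define \<beta> where "\<beta> = \<alpha> * real n"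
  have \<beta>: "\<beta> > 0" using n assms(2) by (simp add: \<beta>_def)
  define P where "P = PiM {1..n} (\<lambda>_. gamma_measure \<alpha>)"
  interpret P: prob_space P unfolding P_def by (rule prob_space_PiM prob_space_gamma_measure assms)+
  have [measurable_cong, simp]: "sets P = sets (PiM {1..n} (\<lambda>_. borel))" unfolding P_def by (intro sets_PiM_cong) auto
  define U where "U = U_sq (\<lambda>i x::nat \<Rightarrow> real. x i) n"
  have [measurable]: "U \<in> borel_measurable (PiM {1..n} (\<lambda>_. borel))" unfolding U_def U_sq_def by measurable
  define len where "len = 1 - 1 / real n"
  have len: "len > 0" using n by (simp add: len_def)
  define W where "W = (\<lambda>z. (U z - 1 / real n) / len)"
  have [measurable]: "W \<in> borel_measurable (PiM {1..n} (\<lambda>_. borel))" unfolding W_def by measurable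
  define y where "y = x / len"
  have y: "0 \<le> y" "y \<le> 1" using assms(6,7) len by (auto simp: y_def len_def[symmetric])

  have X[measurable]: "X i \<in> borel_measurable M" if "i \<in> {1..n}" for i
    using assms(5)[OF that] by (auto simp: distributed_def)
  have lawX: "distr M borel (X i) = gamma_measure \<alpha>" if "i \<in> {1..n}" for i
  proof -
    have "distr M borel (X i) = distr M lborel (X i)" by (rule distr_cong) auto
    then show ?thesis using assms(5)[OF that] by (simp add: distributed_def gamma_measure_def)
  qed
  have law: "distr M (PiM {1..n} (\<lambda>_. borel)) (\<lambda>\<omega>. \<lambda>i\<in>{1..n}. X i \<omega>) = P"
  proof -
    have "distr M (PiM {1..n} (\<lambda>_. borel)) (\<lambda>\<omega>. \<lambda>i\<in>{1..n}. X i \<omega>) = PiM {1..n} (\<lambda>i. distr M borel (X i))"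
      using M.indep_vars_iff_distr_eq_PiM'[of "{1..n}" X "\<lambda>_. borel"] assms(4) n X by auto
    also have "\<dots> = P" unfolding P_def by (intro PiM_cong lawX) auto
    finally show ?thesis .
  qed
  have prob: "measure M {\<omega> \<in> space M. U_sq X n \<omega> - 1 / real n \<le> x} = measure P {z \<in> space P. W z \<le> y}"
  proof -
    have [measurable]: "(\<lambda>\<omega>. \<lambda>i\<in>{1..n}. X i \<omega>) \<in> measurable M (PiM {1..n} (\<lambda>_. borel))"
      using X by (intro measurable_restrict) auto
    have M: "{z \<in> space P. W z \<le> y} \<in> sets P" by measurable
    have "measure P {z \<in> space P. W z \<le> y} = measure M ((\<lambda>\<omega>. \<lambda>i\<in>{1..n}. X i \<omega>) -` {z \<in> space P. W z \<le> y} \<inter> space M)"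
      by (subst law[symmetric], rule measure_distr) (use M in auto)
    also have "(\<lambda>\<omega>. \<lambda>i\<in>{1..n}. X i \<omega>) -` {z \<in> space P. W z \<le> y} \<inter> space M = {\<omega> \<in> space M. U_sq X n \<omega> - 1 / real n \<le> x}"
    proof -
      have "U (\<lambda>i\<in>{1..n}. X i \<omega>) = U_sq X n \<omega>" for \<omega> by (simp add: U_def U_sq_def)
      then show ?thesis using len by (auto simp: W_def y_def divide_right_mono divide_le_cancel P_def space_PiM)
    qed
    finally show ?thesis ..
  qed
  \<comment> \<open>The sawtooth sums take mean values at their jumps, so the values of \<open>W\<close> where a jump may occur have to be null.\<close>
  have AE_W: "AE z in P. 0 < W z \<and> W z < 1 \<and> W z \<noteq> y"
  proof -
    have ne: "AE z in P. U z \<noteq> c" for c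
    proof -
      have "{1..n} = insert 1 {2..n}" using n by auto
      then show ?thesis
        unfolding P_def U_def U_sq_def by (simp only:) (rule AE_shape_ne, use assms(2) n in auto)
    qed
    have posP: "AE x in P. \<forall>i\<in>{1..n}. x i > 0"
      unfolding P_def by (intro AE_finite_allI AE_PiM_component AE_gamma_measure_pos prob_space_gamma_measure assms) auto
    show ?thesis
      using ne[of "1 / real n"] ne[of 1] ne[of "len * y + 1 / real n"] posP
    proof eventually_elim
      case (elim z)
      then have "1 / real n \<le> U z" "U z \<le> 1" using U_sq_bounds[of n z] n by (auto simp: U_def)
      then show ?case using elim len by (auto simp: W_def field_simps) (auto simp: len_def field_simps)
    qed
  qed
  define wnd where "wnd = (\<lambda>K z. \<Sum>k=1..K. sin (real k * pi * W z) * ((1 - cos (real k * pi * y)) / real k))"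
  have [measurable]: "wnd K \<in> borel_measurable (PiM {1..n} (\<lambda>_. borel))" for K unfolding wnd_def by measurable
  define f where "f = (\<lambda>k s. Im (psi \<alpha> s (t_node \<alpha> n k) ^ n *
            exp (- \<i> * complex_of_real (\<alpha> * real n * s)
                 - \<i> * complex_of_real (inverse (real n - 1) * real k * pi))))"
  have f_int: "integrable lborel (f k)" and f_eq: "integral\<^sup>L lborel (f k) = 2 * pi * gamma_density \<beta> \<beta> * (\<integral>z. sin (real k * pi * W z) \<partial>P)"
    if "k \<ge> 1" for k
    using summand_integral[OF assms(2) n(2,1) that] by (simp_all add: f_def \<beta>_def P_def W_def U_def len_def)
  have pi_eq: "partial_integrand \<alpha> n x K = (\<lambda>s. \<Sum>k=1..K. f k s * ((1 - cos (real k * pi * y)) / real k))" for K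
    unfolding partial_integrand_def f_def y_def len_def by (simp add: divide_inverse mult_ac)
  have int: "integrable lborel (partial_integrand \<alpha> n x K)" for K
    unfolding pi_eq by (intro Bochner_Integration.integrable_sum integrable_mult_left f_int) auto
  have val: "(LBINT s. partial_integrand \<alpha> n x K s) = 2 * pi * gamma_density \<beta> \<beta> * (\<integral>z. wnd K z \<partial>P)" for K
  proof -
    have "(LBINT s. partial_integrand \<alpha> n x K s) = (\<Sum>k=1..K. integral\<^sup>L lborel (f k) * ((1 - cos (real k * pi * y)) / real k))"
      unfolding pi_eq by (subst Bochner_Integration.integral_sum) (auto intro!: integrable_mult_left f_int)
    also have "\<dots> = 2 * pi * gamma_density \<beta> \<beta> * (\<Sum>k=1..K. (\<integral>z. sin (real k * pi * W z) \<partial>P) * ((1 - cos (real k * pi * y)) / real k))"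
      unfolding sum_distrib_left by (intro sum.cong refl) (simp add: f_eq)
    also have "(\<Sum>k=1..K. (\<integral>z. sin (real k * pi * W z) \<partial>P) * ((1 - cos (real k * pi * y)) / real k)) = (\<integral>z. wnd K z \<partial>P)"
    proof -
      have "integrable P (\<lambda>z. sin (real k * pi * W z))" for k
        by (intro P.integrable_const_bound[of _ 1]) auto
      then show ?thesis
        unfolding wnd_def by (subst Bochner_Integration.integral_sum) (auto simp only: integrable_mult_left integral_mult_left_zero)
    qed
    finally show ?thesis .
  qed
  have "(\<lambda>K. \<integral>z. wnd K z \<partial>P) \<longlonglongrightarrow> (\<integral>z. (if W z \<le> y then pi / 2 else 0) \<partial>P)"
  proof (rule integral_dominated_convergence[where w = "\<lambda>_. 4 + 4 * pi"])
    show "AE z in P. (\<lambda>K. wnd K z) \<longlonglongrightarrow> (if W z \<le> y then pi / 2 else 0)"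
      using AE_W by eventually_elim (unfold wnd_def, intro window_sum_tendsto y, auto)
    show "AE z in P. norm (wnd K z) \<le> 4 + 4 * pi" for K
      using AE_W by eventually_elim (unfold wnd_def real_norm_def, intro window_sum_bounded y, auto)
  qed auto
  also have "(\<integral>z. (if W z \<le> y then pi / 2 else 0) \<partial>P) = pi / 2 * measure P {z \<in> space P. W z \<le> y}"
  proof -
    have M: "{z \<in> space P. W z \<le> y} \<in> sets P" by measurable
    have "(\<integral>z. (if W z \<le> y then pi / 2 else 0) \<partial>P) = (\<integral>z. pi / 2 * indicator {z \<in> space P. W z \<le> y} z \<partial>P)"
      by (intro Bochner_Integration.integral_cong) auto
    also have "\<dots> = pi / 2 * measure P {z \<in> space P. W z \<le> y}"
      using M by (simp only: integral_mult_right_zero integral_indicator) (simp add: Int_absorb2)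
    finally show ?thesis .
  qed
  finally have lim: "(\<lambda>K. LBINT s. partial_integrand \<alpha> n x K s) \<longlonglongrightarrow>
      2 * pi * gamma_density \<beta> \<beta> * (pi / 2 * measure P {z \<in> space P. W z \<le> y})"
    unfolding val by (intro tendsto_mult_left)
  have "Gamma (\<beta> + 1) / (pi\<^sup>2 * (\<beta> / exp 1) powr \<beta>) * lim (\<lambda>K. LBINT s. partial_integrand \<alpha> n x K s)
     = (Gamma (\<beta> + 1) / (pi\<^sup>2 * (\<beta> / exp 1) powr \<beta>) * (2 * pi * gamma_density \<beta> \<beta>)) * (pi / 2 * measure P {z \<in> space P. W z \<le> y})"
    unfolding limI[OF lim] by (simp only: mult.assoc)
  also have "\<dots> = measure P {z \<in> space P. W z \<le> y}" unfolding prefactor_times_density[OF \<beta>] by simp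
  finally show ?thesis
    using int lim prob by (auto simp: convergent_def \<beta>_def)
qed

end
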